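(* Let $\Omega\subset\mathbb R^d$ be bounded with a sufficiently smooth (say $C^\infty$, in particular Lipschitz) boundary. Let $k$ be a strictly positive definite continuous kernel with $k(x,x)\le1$ for all $x\in\Omega$, which is well defined on the closure $\bar\Omega$ (it can be evaluated there and is continuous and strictly positive definite on $\bar\Omega$), and such that the extension $E:\mathcal H_k(\Omega)\to\mathcal H_k(\bar\Omega)$ satisfies $\|Ef\|_{\mathcal H_k(\bar\Omega)}=\|f\|_{\mathcal H_k(\Omega)}$ for all $f\in\mathcal H_k(\Omega)$. Let $\tau>d/2$, and assume that $\mathcal H_k(\Omega)$ is continuously embedded into $W_2^\tau(\Omega)$ and, with $s:=\tau-d/2$, into $\mathrm{Lip}(s,L_\infty(\Omega))$. Assume additionally that $\mathcal H_k(\Omega)$ is norm equivalent to $W_2^\tau(\Omega)$. Then the error bound (B) of the context, with $\gamma=1$ (i.e. for the $P$-greedy algorithm, $\beta=0$, $\gamma=1$), implies that there is $c'>0$ such that the selected points satisfy $$\|P_{X_{2n}}\|_{L_\infty(\Omega)}\le c'(2n)^{-\frac\tau d+\frac12},\qquad n\in\mathbb N.$$ In view of the known lower bound (L) of the context, it is not possible to improve the rates of the bounds (E) and (K), nor the rates of the bounds (B) and (T) (which are the case $\beta=0$ of error bounds for the scale of weak $\beta$-greedy algorithms).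
   Context: $\mathcal H_k(\Omega)$ is the Reproducing Kernel Hilbert Space of $k$ on $\Omega$. For a finite set $X\subset\Omega$ of pairwise distinct points, $V(X):=\mathrm{span}\{k(\cdot,x):x\in X\}$ and $I_Xf\in V(X)$ is the unique interpolant of $f$ at $X$ (the orthogonal projection of $f$ onto $V(X)$ if $f\in\mathcal H_k(\Omega)$). The power function is $P_X(x):=\|k(\cdot,x)-\Pi_{V(X)}k(\cdot,x)\|_{\mathcal H_k(\Omega)}$, with $\Pi_V$ the orthogonal projection onto $V$. $W_2^\tau(\Omega)$ is the $L_2$-based Sobolev space of order $\tau$; norm equivalent means equal as sets with equivalent norms. For $s=m+\alpha$ with $m\in\mathbb N_0$, $\alpha\in(0,1]$, $|f|_{\mathrm{Lip}(s,L_\infty(\Omega))}:=\max_{|\zeta|=m}\sup_{y\ne z\in\Omega}|D^\zeta f(y)-D^\zeta f(z)|/|y-z|^\alpha$, and $\mathrm{Lip}(s,L_\infty(\Omega))$ is the set of $f$ for which this is finite. $\mathcal H_k(\Omega)$ is continuously embedded into it if it is contained in it and there is $c_e>0$ with $|u|_{\mathrm{Lip}(s,L_\infty(\Omega))}\le c_e\|u\|_{\mathcal H_k(\Omega)}$ for all $u\in\mathcal H_k(\Omega)$. Weak $\beta$-greedy algorithm for $\beta=0$: $X_0:=\emptyset$, $X_{n+1}:=X_n\cup\{x_{n+1}\}$, where $x_{n+1}\in\{x\in\Omega: P_{X_n}(x)\ge\gamma\sup_{z\in\Omega}P_{X_n}(z)\}$ and $\gamma$ is admissible, meaning $\gamma\in(0,1)$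 if $\Omega$ is open and $\gamma\in(0,1]$ if $\Omega$ is closed. For $\gamma=1$ this is the $P$-greedy algorithm. $\Phi(\Omega):=\{k(\cdot,x):x\in\Omega\}$. For a subset $K$ of a Hilbert space $\mathcal H$: $\mathrm{co}(K):=\mathrm{clos}_{\mathcal H}\{\sum_ic_ig_i:g_i\in K,\ \sum_i|c_i|\le1\}$; $\varepsilon_n(K,\mathcal H)$ is the infimum of all $\varepsilon>0$ such that $K$ can be covered by $2^n$ balls of radius $\varepsilon$; $d_n(K,\mathcal H):=\inf_{\dim V_n\le n}\sup_{f\in K}\inf_{g\in V_n}\|f-g\|_{\mathcal H}$ over subspaces $V_n\subset\mathcal H$. Put $\varepsilon_n:=\varepsilon_n(\mathrm{co}(\Phi(\Omega)),\mathcal H_k(\Omega))$. The bounds referred to in the claim, valid for all $n\in\mathbb N$, are the following. (E) $\varepsilon_n\le C\,n^{-\frac sd-\frac12}$ and (K) $d_n(\mathrm{co}(\Phi(\Omega)),\mathcal H_k(\Omega))\le C'n^{-\frac sd}$, with constants $C,C'>0$, when $\mathcal H_k(\Omega)$ is continuously embedded into $\mathrm{Lip}(s,L_\infty(\Omega))$ and the boundary of $\Omega$ is sufficiently smooth. (T) $\min_{n+1\le i\le2n}\|f-I_{X_i}f\|_{L_\infty(\Omega)}\le\gamma^{-1}\sqrt5\,n^{\frac12}\varepsilon_n\,\|f-I_{X_{n+1}}f\|_{\mathcal H_k(\Omega)}$ for all $f\in\mathcal H_k(\Omega)$. (B) $\min_{n+1\le i\le2n}\|f-I_{X_i}f\|_{L_\infty(\Omega)}\le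 c\,\gamma^{-1}n^{-\frac\tau d+\frac12}\|f-I_{X_{n+1}}f\|_{\mathcal H_k(\Omega)}$ for all $f\in\mathcal H_k(\Omega)$, with $c:=C\sqrt5$. (L) Known from the literature: if $\mathcal H_k(\Omega)$ is norm equivalent to $W_2^\tau(\Omega)$, there is $c>0$ such that for any point distribution $c\,n^{-\frac\tau d+\frac12}\le\|P_{X_n}\|_{L_\infty(\Omega)}$, $n\in\mathbb N$. *)

theory Defs
  imports
    "HOL-Analysis.Analysis"
    "HOL-Probability.Essential_Supremum"
    "HOL-Library.Landau_Symbols"
begin

section \<open>Derivatives and smooth boundaries\<close>

type_synonym 'd multi_index = "'d \<Rightarrow> nat"

definition mi_order :: "('d::finite) multi_index \<Rightarrow> nat" where
  "mi_order \<zeta> = (\<Sum>i\<in>UNIV. \<zeta> i)"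

text \<open>
  \<open>D\<close> is the family of the partial derivatives of \<open>f\<close> on \<open>S\<close> up to order \<open>m\<close>: the gradient of
  \<open>D \<zeta>\<close> has the components \<open>D (\<zeta> + e\<^sub>i)\<close>. Derivatives are taken within \<open>S\<close>, so that \<open>S\<close> may be
  open or the closure of a smooth domain; in both cases \<open>f\<close> determines \<open>D \<zeta>\<close> on \<open>S\<close> for all
  \<open>\<zeta>\<close> of order at most \<open>m\<close>. Values of \<open>D \<zeta>\<close> for larger orders are irrelevant.
\<close>

definition partials ::
  "nat \<Rightarrow> (real^'d::finite) set \<Rightarrow> (real^'d \<Rightarrow> real) \<Rightarrow> ('d multi_index \<Rightarrow> real^'d \<Rightarrow> real) \<Rightarrow> bool"
where
  "partials m S f D \<longleftrightarrow>
     (\<forall>x\<in>S. D (\<lambda>_. 0) x = f x) \<and>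
     (\<forall>\<zeta>. mi_order \<zeta> < m \<longrightarrow> (\<forall>x\<in>S.
        (D \<zeta> has_derivative (\<lambda>h. \<Sum>i\<in>UNIV. D (\<zeta>(i := Suc (\<zeta> i))) x * h $ i)) (at x within S)))"

definition smooth_partials ::
  "(real^'d::finite) set \<Rightarrow> (real^'d \<Rightarrow> real) \<Rightarrow> ('d multi_index \<Rightarrow> real^'d \<Rightarrow> real) \<Rightarrow> bool"
where
  "smooth_partials S f D \<longleftrightarrow> (\<forall>m. partials m S f D)"

text \<open>
  Boundary of class \<open>C\<^sup>\<infinity>\<close>, by local defining functions: locally the boundary is a smooth
  hypersurface with the interior of \<open>\<Omega>\<close> on one side and the exterior on the other.
\<close>

definition smooth_boundary :: "(real^'d::finite) set \<Rightarrow> bool" where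
  "smooth_boundary \<Omega> \<longleftrightarrow>
     (\<forall>x\<in>frontier \<Omega>. \<exists>U \<rho> D. open U \<and> x \<in> U \<and> smooth_partials U \<rho> D \<and>
        (\<forall>y\<in>U. \<not> (\<rho> has_derivative (\<lambda>_. 0)) (at y)) \<and>
        U \<inter> interior \<Omega> = {y\<in>U. \<rho> y < 0} \<and>
        U \<inter> frontier \<Omega> = {y\<in>U. \<rho> y = 0})"

section \<open>Function spaces\<close>

definition Linf_norm :: "(real^'d::finite) set \<Rightarrow> (real^'d \<Rightarrow> real) \<Rightarrow> ereal" where
  "Linf_norm \<Omega> f = esssup (lebesgue_on \<Omega>) (\<lambda>x. ereal \<bar>f x\<bar>)"

text \<open>
  For \<open>s > 0\<close>, \<open>s = m + \<alpha>\<close> with \<open>m = \<lceil>s\<rceil> - 1\<close> and \<open>\<alpha> \<in> (0,1]\<close>. As the derivative family is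
  unique on \<open>\<Omega>\<close>, the infimum only serves to assign \<open>\<infinity>\<close> to functions that lack derivatives of
  order \<open>m\<close>. Continuity of the derivatives of order \<open>m\<close> follows from finiteness.
\<close>

definition Lip_seminorm ::
  "real \<Rightarrow> (real^'d::finite) set \<Rightarrow> (real^'d \<Rightarrow> real) \<Rightarrow> ennreal"
where
  "Lip_seminorm s \<Omega> f =
     (let m = nat (\<lceil>s\<rceil> - 1); \<alpha> = s - real m in
      INF D\<in>{D. partials m \<Omega> f D}. SUP \<zeta>\<in>{\<zeta>. mi_order \<zeta> = m}. SUP y\<in>\<Omega>. SUP z\<in>\<Omega> - {y}.
        ennreal (\<bar>D \<zeta> y - D \<zeta> z\<bar> / norm (y - z) powr \<alpha>))"

text \<open>
  \<open>v \<zeta>\<close> is the weak derivative of order \<open>\<zeta>\<close> of \<open>u\<close> on the open set \<open>G\<close>, and lies in \<open>L\<^sub>2(G)\<close>;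
  \<open>\<psi>\<close> ranges over the derivative families of the test functions \<open>\<psi> 0\<close>.
\<close>

definition weak_partials ::
  "nat \<Rightarrow> (real^'d::finite) set \<Rightarrow> (real^'d \<Rightarrow> real) \<Rightarrow> ('d multi_index \<Rightarrow> real^'d \<Rightarrow> real) \<Rightarrow> bool"
where
  "weak_partials m G u v \<longleftrightarrow>
     (AE x in lebesgue_on G. v (\<lambda>_. 0) x = u x) \<and>
     (\<forall>\<zeta>. mi_order \<zeta> \<le> m \<longrightarrow>
        v \<zeta> \<in> borel_measurable (lebesgue_on G) \<and>
        integrable (lebesgue_on G) (\<lambda>x. (v \<zeta> x)\<^sup>2) \<and>
        (\<forall>\<psi>. smooth_partials UNIV (\<psi> (\<lambda>_. 0)) \<psi> \<and>
             compact (closure {x. \<psi> (\<lambda>_. 0) x \<noteq> 0}) \<and> closure {x. \<psi> (\<lambda>_. 0) x \<noteq> 0} \<subseteq> G \<longrightarrow>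
           (\<integral>x. u x * \<psi> \<zeta> x \<partial>lebesgue_on G)
             = (-1) ^ mi_order \<zeta> * (\<integral>x. v \<zeta> x * \<psi> (\<lambda>_. 0) x \<partial>lebesgue_on G)))"

text \<open>
  The space \<open>W\<^sub>2\<^sup>\<tau>(\<Omega>)\<close> for real \<open>\<tau> \<ge> 0\<close>, with the Sobolev--Slobodeckij norm on the interior of
  \<open>\<Omega>\<close> (the boundaries considered are null sets). The squared norm is \<open>\<infinity>\<close> for functions outside
  the space; weak derivatives being unique almost everywhere, the infimum only accounts for
  their absence.
\<close>

definition sobolev_norm_sq ::
  "real \<Rightarrow> (real^'d::finite) set \<Rightarrow> (real^'d \<Rightarrow> real) \<Rightarrow> ennreal"
where
  "sobolev_norm_sq \<tau> \<Omega> u =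
     (let G = interior \<Omega>; m = nat \<lfloor>\<tau>\<rfloor>; \<sigma> = \<tau> - real m in
      INF v\<in>{v. weak_partials m G u v}.
        (\<Sum>\<zeta> | mi_order \<zeta> \<le> m. \<integral>\<^sup>+x. ennreal ((v \<zeta> x)\<^sup>2) \<partial>lebesgue_on G)
        + (if \<sigma> = 0 then 0 else
            (\<Sum>\<zeta> | mi_order \<zeta> = m. \<integral>\<^sup>+x. (\<integral>\<^sup>+y.
               ennreal ((v \<zeta> x - v \<zeta> y)\<^sup>2 / norm (x - y) powr (real CARD('d) + 2 * \<sigma>))
               \<partial>lebesgue_on G) \<partial>lebesgue_on G)))"

definition sobolev_space :: "real \<Rightarrow> (real^'d::finite) set \<Rightarrow> (real^'d \<Rightarrow> real) set" where
  "sobolev_space \<tau> \<Omega> = {u. sobolev_norm_sq \<tau> \<Omega> u < \<infinity>}"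

definition sobolev_norm :: "real \<Rightarrow> (real^'d::finite) set \<Rightarrow> (real^'d \<Rightarrow> real) \<Rightarrow> real" where
  "sobolev_norm \<tau> \<Omega> u = sqrt (enn2real (sobolev_norm_sq \<tau> \<Omega> u))"

section \<open>Kernels and their Hilbert spaces\<close>

definition strictly_pos_def_kernel :: "'x set \<Rightarrow> ('x \<Rightarrow> 'x \<Rightarrow> real) \<Rightarrow> bool" where
  "strictly_pos_def_kernel S k \<longleftrightarrow>
     (\<forall>x\<in>S. \<forall>y\<in>S. k x y = k y x) \<and>
     (\<forall>X c. finite X \<and> X \<subseteq> S \<and> (\<exists>x\<in>X. c x \<noteq> 0) \<longrightarrow> (\<Sum>x\<in>X. \<Sum>y\<in>X. c x * c y * k x y) > 0)"

text \<open>
  The Hilbert space \<open>'h\<close> is the reproducing kernel Hilbert space of \<open>k\<close> on \<open>S\<close>: \<open>ev f x\<close> is the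
  value at \<open>x\<close> of the element \<open>f\<close>, regarded as a function on \<open>S\<close>, and \<open>\<kappa> x\<close> is the element
  \<open>k(\<cdot>,x)\<close>. Elements are determined by their values on \<open>S\<close>; that the vector space operations
  are the pointwise ones follows from the reproducing property.
\<close>

definition is_rkhs ::
  "('h::{real_inner,complete_space} \<Rightarrow> 'x \<Rightarrow> real) \<Rightarrow> ('x \<Rightarrow> 'h) \<Rightarrow> 'x set \<Rightarrow> ('x \<Rightarrow> 'x \<Rightarrow> real) \<Rightarrow> bool"
where
  "is_rkhs ev \<kappa> S k \<longleftrightarrow>
     (\<forall>f g. (\<forall>x\<in>S. ev f x = ev g x) \<longrightarrow> f = g) \<and>
     (\<forall>x\<in>S. \<forall>y\<in>S. ev (\<kappa> x) y = k y x) \<and>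
     (\<forall>f. \<forall>x\<in>S. f \<bullet> \<kappa> x = ev f x)"

definition embedded_in_Lip ::
  "('h::{real_inner,complete_space} \<Rightarrow> real^'d::finite \<Rightarrow> real) \<Rightarrow> real \<Rightarrow> (real^'d) set \<Rightarrow> bool"
where
  "embedded_in_Lip ev s \<Omega> \<longleftrightarrow>
     (\<exists>c>0. \<forall>f. Lip_seminorm s \<Omega> (ev f) \<le> ennreal (c * norm f))"

definition embedded_in_sobolev ::
  "('h::{real_inner,complete_space} \<Rightarrow> real^'d::finite \<Rightarrow> real) \<Rightarrow> real \<Rightarrow> (real^'d) set \<Rightarrow> bool"
where
  "embedded_in_sobolev ev \<tau> \<Omega> \<longleftrightarrow>
     (\<exists>c>0. \<forall>f. ev f \<in> sobolev_space \<tau> \<Omega> \<and> sobolev_norm \<tau> \<Omega> (ev f) \<le> c * norm f)"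

text \<open>Equality as sets is understood up to equality almost everywhere.\<close>

definition norm_equivalent_sobolev ::
  "('h::{real_inner,complete_space} \<Rightarrow> real^'d::finite \<Rightarrow> real) \<Rightarrow> real \<Rightarrow> (real^'d) set \<Rightarrow> bool"
where
  "norm_equivalent_sobolev ev \<tau> \<Omega> \<longleftrightarrow>
     (\<forall>f. ev f \<in> sobolev_space \<tau> \<Omega>) \<and>
     (\<forall>u\<in>sobolev_space \<tau> \<Omega>. \<exists>f. AE x in lebesgue_on \<Omega>. u x = ev f x) \<and>
     (\<exists>c1>0. \<exists>c2>0. \<forall>f. c1 * norm f \<le> sobolev_norm \<tau> \<Omega> (ev f) \<and>
                         sobolev_norm \<tau> \<Omega> (ev f) \<le> c2 * norm f)"

section \<open>Interpolation and greedy selection\<close>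

definition orth_proj :: "'h::real_inner set \<Rightarrow> 'h \<Rightarrow> 'h" where
  "orth_proj V f = (THE g. g \<in> V \<and> (\<forall>v\<in>V. orthogonal (f - g) v))"

definition power_function :: "('x \<Rightarrow> 'h::real_inner) \<Rightarrow> 'x set \<Rightarrow> 'x \<Rightarrow> real" where
  "power_function \<kappa> X x = norm (\<kappa> x - orth_proj (span (\<kappa> ` X)) (\<kappa> x))"

definition interpolant ::
  "('h::real_inner \<Rightarrow> 'x \<Rightarrow> real) \<Rightarrow> ('x \<Rightarrow> 'h) \<Rightarrow> 'x set \<Rightarrow> ('x \<Rightarrow> real) \<Rightarrow> 'h"
where
  "interpolant ev \<kappa> X f = (THE g. g \<in> span (\<kappa> ` X) \<and> (\<forall>x\<in>X. ev g x = f x))"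

text \<open>A run of the algorithm is a sequence \<open>x 1, x 2, \<dots>\<close>; \<open>x 0\<close> is not used.\<close>

definition selected :: "(nat \<Rightarrow> 'x) \<Rightarrow> nat \<Rightarrow> 'x set" where
  "selected x n = x ` {1..n}"

definition weak_greedy ::
  "('x \<Rightarrow> 'h::real_inner) \<Rightarrow> 'x set \<Rightarrow> real \<Rightarrow> (nat \<Rightarrow> 'x) \<Rightarrow> bool"
where
  "weak_greedy \<kappa> \<Omega> \<gamma> x \<longleftrightarrow>
     (\<forall>n. x (Suc n) \<in> \<Omega> \<and>
          power_function \<kappa> (selected x n) (x (Suc n))
            \<ge> \<gamma> * (SUP z\<in>\<Omega>. power_function \<kappa> (selected x n) z))"

definition admissible :: "'x::topological_space set \<Rightarrow> real \<Rightarrow> bool" where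
  "admissible \<Omega> \<gamma> \<longleftrightarrow> (open \<Omega> \<and> 0 < \<gamma> \<and> \<gamma> < 1) \<or> (closed \<Omega> \<and> 0 < \<gamma> \<and> \<gamma> \<le> 1)"

definition greedy_error_bound ::
  "('h::real_inner \<Rightarrow> real^'d::finite \<Rightarrow> real) \<Rightarrow> (real^'d \<Rightarrow> 'h) \<Rightarrow> (real^'d) set
     \<Rightarrow> (nat \<Rightarrow> real^'d) \<Rightarrow> (nat \<Rightarrow> real) \<Rightarrow> bool"
where
  "greedy_error_bound ev \<kappa> \<Omega> x \<rho> \<longleftrightarrow>
     (\<forall>n\<ge>1. \<forall>f.
        Min ((\<lambda>i. Linf_norm \<Omega> (\<lambda>y. ev f y - ev (interpolant ev \<kappa> (selected x i) (ev f)) y))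
               ` {n + 1..2 * n})
        \<le> ereal (\<rho> n * norm (f - interpolant ev \<kappa> (selected x (n + 1)) (ev f))))"

section \<open>Entropy numbers and widths\<close>

definition co :: "'h::real_normed_vector set \<Rightarrow> 'h set" where
  "co K = closure {\<Sum>g\<in>S. c g *\<^sub>R g | S c. finite S \<and> S \<subseteq> K \<and> (\<Sum>g\<in>S. \<bar>c g\<bar>) \<le> 1}"

definition entropy_number :: "nat \<Rightarrow> 'h::metric_space set \<Rightarrow> real" where
  "entropy_number n K =
     Inf {\<epsilon>. \<epsilon> > 0 \<and> (\<exists>C. finite C \<and> card C \<le> 2 ^ n \<and> K \<subseteq> (\<Union>c\<in>C. cball c \<epsilon>))}"

text \<open>
  Subspaces of dimension at most \<open>n\<close> are written as spans of at most \<open>n\<close> vectors, because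
  \<^const>\<open>dim\<close> is 0 on infinite-dimensional spaces.
\<close>

definition kolmogorov_width :: "nat \<Rightarrow> 'h::real_normed_vector set \<Rightarrow> real" where
  "kolmogorov_width n K =
     (INF V\<in>{span B | B. finite B \<and> card B \<le> n}. SUP f\<in>K. infdist f V)"

section \<open>Optimality of rates\<close>

text \<open>
  The rate \<open>r\<close> of a bound cannot be improved: whichever \<open>\<rho>\<close> makes the bound valid decays at most
  as fast as \<open>r\<close>. In particular neither \<open>\<rho> \<in> o(r)\<close> nor, for \<open>r(n) = n\<^sup>-\<^sup>a\<close>, a larger exponent is
  possible.
\<close>

definition rate_not_improvable :: "(nat \<Rightarrow> real) \<Rightarrow> ((nat \<Rightarrow> real) \<Rightarrow> bool) \<Rightarrow> bool" where
  "rate_not_improvable r valid \<longleftrightarrow> (\<forall>\<rho>. valid \<rho> \<longrightarrow> r \<in> O(\<rho>))"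

end

theory Submission
  imports Defs
begin

text \<open>
  Apply the error bound at stage \<open>n\<close> to the residual \<open>f\<close> of \<open>k(\<cdot>,z)\<close> with respect to \<open>V(X\<^sub>2\<^sub>n)\<close>. As \<open>f\<close>
  vanishes on \<open>X\<^sub>2\<^sub>n\<close>, all interpolants involved are 0, and since \<open>\<parallel>f\<parallel> = P(z)\<close> and \<open>f(z) = P(z)\<^sup>2\<close> with
  \<open>P\<close> the power function of \<open>X\<^sub>2\<^sub>n\<close>, the bound becomes \<open>P(z) \<le> \<rho>(n)\<close>. Together with
  (L) this bounds every valid rate \<open>\<rho>\<close> from below, and through (T), for a run with \<open>\<gamma> = 1/2\<close>, also the
  entropy numbers.

  The Kolmogorov width is bounded from below without the entropy numbers. For \<open>2m\<close> points that almost
  maximise the Gram determinant, the residual of each \<open>k(\<cdot>,x)\<close> with respect to all the others is by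
  (L) at least of order \<open>m\<close> to the power \<open>-s/d\<close>; hence the dual basis is correspondingly small. A space
  \<open>V\<close> of dimension \<open>m\<close> captures at most half of the trace of the identity on the span, and the dual
  basis turns the missing half into a lower bound for the distances of the \<open>k(\<cdot>,x)\<close> to \<open>V\<close>.
\<close>

section \<open>Projections onto finitely spanned subspaces\<close>

lemma orth_proj_eqI:
  fixes f g :: "'h::real_inner"
  assumes "g \<in> span B" and "\<And>b. b \<in> B \<Longrightarrow> (f - g) \<bullet> b = 0"
  shows "orth_proj (span B) f = g"
  unfolding orth_proj_def
proof (rule the_equality)
  have perp: "(f - g) \<bullet> v = 0" if "v \<in> span B" for v
    using orthogonal_to_span[OF that, of "f - g"] assms(2) by (simp add: orthogonal_def)
  then show "g \<in> span B \<and> (\<forall>v\<in>span B. orthogonal (f - g) v)"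
    using assms(1) by (simp add: orthogonal_def)
  show "h = g" if h: "h \<in> span B \<and> (\<forall>v\<in>span B. orthogonal (f - h) v)" for h
  proof -
    have "h - g \<in> span B"
      using h assms(1) by (simp add: span_diff)
    then have "(f - g) \<bullet> (h - g) = 0" "(f - h) \<bullet> (h - g) = 0"
      using perp h by (auto simp: orthogonal_def)
    then have "(h - g) \<bullet> (h - g) = 0"
      by (simp add: inner_diff_left)
    then show ?thesis
      by simp
  qed
qed

lemma residual_orthogonal_basis:
  fixes f :: "'h::real_inner"
  assumes "finite C" and "pairwise orthogonal C" and "b \<in> C"
  shows "(f - (\<Sum>v\<in>C. (v \<bullet> f / (v \<bullet> v)) *\<^sub>R v)) \<bullet> b = 0"
proof -
  \<comment> \<open>The case \<open>b = 0\<close> is covered: division by zero makes its coefficient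
    0, and \<open>b \<bullet> f\<close> vanishes too.\<close>
  have "(\<Sum>v\<in>C. (v \<bullet> f / (v \<bullet> v)) *\<^sub>R v) \<bullet> b = (\<Sum>v\<in>C. if v = b then b \<bullet> f else 0)"
    unfolding inner_sum_left
    using assms(2,3) by (intro sum.cong) (auto simp: pairwise_def orthogonal_def)
  also have "\<dots> = f \<bullet> b"
    using assms(1,3) by (simp add: inner_commute)
  finally show ?thesis
    by (simp add: inner_diff_left)
qed

lemma orth_proj_orthogonal_basis:
  fixes f :: "'h::real_inner"
  assumes "finite C" and "pairwise orthogonal C"
  shows "orth_proj (span C) f = (\<Sum>v\<in>C. (v \<bullet> f / (v \<bullet> v)) *\<^sub>R v)"
  using residual_orthogonal_basis[OF assms]
  by (intro orth_proj_eqI span_sum span_mul span_base)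

text \<open>As \<open>orth_proj\<close> is a definite description, both facts rest on existence;
  Gram-Schmidt supplies an orthogonal basis for which the projection is explicit.\<close>

lemma
  fixes f :: "'h::real_inner"
  assumes "finite B"
  shows orth_proj_in_span: "orth_proj (span B) f \<in> span B"
    and orth_proj_perp: "v \<in> span B \<Longrightarrow> (f - orth_proj (span B) f) \<bullet> v = 0"
proof -
  obtain C where C: "finite C" "span C = span B" "pairwise orthogonal C"
    using basis_orthogonal[OF assms] by blast
  define g where "g = (\<Sum>v\<in>C. (v \<bullet> f / (v \<bullet> v)) *\<^sub>R v)"
  have proj: "orth_proj (span B) f = g"
    using orth_proj_orthogonal_basis[OF C(1,3)] C(2) by (simp add: g_def)
  have "g \<in> span C"
    unfolding g_def by (intro span_sum span_mul span_base)
  then show "orth_proj (span B) f \<in> span B"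
    using proj C(2) by simp
  have "(f - g) \<bullet> v = 0" if "v \<in> span C" for v
    using orthogonal_to_span[OF that, of "f - g"] residual_orthogonal_basis[OF C(1,3)]
    by (simp add: orthogonal_def g_def)
  then show "v \<in> span B \<Longrightarrow> (f - orth_proj (span B) f) \<bullet> v = 0"
    using proj C(2) by simp
qed

lemma norm_diff_orth_proj_le:
  fixes f :: "'h::real_inner"
  assumes "finite B" and "v \<in> span B"
  shows "norm (f - orth_proj (span B) f) \<le> norm (f - v)"
proof -
  define g where "g = orth_proj (span B) f"
  have "g - v \<in> span B"
    using assms by (simp add: g_def orth_proj_in_span span_diff)
  then have "orthogonal (f - g) (g - v)"
    using orth_proj_perp[OF assms(1)] by (simp add: g_def orthogonal_def)
  then have "(norm (f - v))\<^sup>2 = (norm (f - g))\<^sup>2 + (norm (g - v))\<^sup>2"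
    using norm_add_Pythagorean[of "f - g" "g - v"] by simp
  then show ?thesis
    unfolding g_def by (auto intro: power2_le_imp_le[OF _ norm_ge_zero])
qed

text \<open>Through this identity the power function inherits from \<open>infdist\<close> its
  continuity in the point and its monotonicity in the subspace.\<close>

lemma norm_diff_orth_proj:
  fixes f :: "'h::real_inner"
  assumes "finite B"
  shows "norm (f - orth_proj (span B) f) = infdist f (span B)"
proof (rule antisym)
  have ne: "span B \<noteq> {}"
    using span_zero by blast
  show "norm (f - orth_proj (span B) f) \<le> infdist f (span B)"
    unfolding infdist_notempty[OF ne]
    by (rule cINF_greatest[OF ne]) (simp add: dist_norm norm_diff_orth_proj_le[OF assms])
  show "infdist f (span B) \<le> norm (f - orth_proj (span B) f)"
    using infdist_le[OF orth_proj_in_span[OF assms]] by (simp add: dist_norm)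
qed

lemma power_function_eq_infdist:
  "finite X \<Longrightarrow> power_function \<kappa> X x = infdist (\<kappa> x) (span (\<kappa> ` X))"
  by (simp add: power_function_def norm_diff_orth_proj)

lemma power_function_nonneg: "0 \<le> power_function \<kappa> X x"
  by (simp add: power_function_def)

lemma power_function_eq_0:
  "finite X \<Longrightarrow> \<kappa> x \<in> span (\<kappa> ` X) \<Longrightarrow> power_function \<kappa> X x = 0"
  by (simp add: power_function_eq_infdist)

lemma power_function_le_norm: "finite X \<Longrightarrow> power_function \<kappa> X x \<le> norm (\<kappa> x)"
  using infdist_le[OF span_zero, of "\<kappa> x" "\<kappa> ` X"]
  by (simp add: power_function_eq_infdist dist_norm)

lemma continuous_on_power_function:
  assumes "finite X" and "continuous_on S \<kappa>"
  shows "continuous_on S (power_function \<kappa> X)"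
  unfolding power_function_eq_infdist[OF assms(1), abs_def]
  using assms(2) by (rule continuous_on_infdist)

section \<open>Fekete points and Kolmogorov widths\<close>

text \<open>Both sides are the area of the parallelogram spanned by the residuals of \<open>\<kappa> x\<close> and \<open>\<kappa> y\<close>.\<close>

lemma power_function_exchange:
  fixes \<kappa> :: "'x \<Rightarrow> 'h::real_inner"
  assumes "finite X"
  shows "power_function \<kappa> X x * power_function \<kappa> (insert x X) y
    = power_function \<kappa> X y * power_function \<kappa> (insert y X) x"
proof -
  define r where "r x = \<kappa> x - orth_proj (span (\<kappa> ` X)) (\<kappa> x)" for x
  have fin: "finite (\<kappa> ` X)"
    using assms by simp
  have r_perp: "r x \<bullet> b = 0" if "b \<in> span (\<kappa> ` X)" for x b
    using orth_proj_perp[OF fin that] by (simp add: r_def)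
  have area: "(power_function \<kappa> X x * power_function \<kappa> (insert x X) y)\<^sup>2
      = (r x \<bullet> r x) * (r y \<bullet> r y) - (r x \<bullet> r y)\<^sup>2" for x y
  proof (cases "r x = 0")
    case True
    then show ?thesis
      by (simp add: power_function_def r_def)
  next
    case False
    \<comment> \<open>One Gram-Schmidt step: subtracting \<open>c *\<^sub>R r x\<close> makes the
      residual of \<open>\<kappa> y\<close> orthogonal to \<open>\<kappa> x\<close> as well.\<close>
    define c where "c = (r x \<bullet> r y) / (r x \<bullet> r x)"
    define g where "g = orth_proj (span (\<kappa> ` X)) (\<kappa> y) + c *\<^sub>R r x"
    have sub: "span (\<kappa> ` X) \<subseteq> span (\<kappa> ` insert x X)"
      by (intro span_mono) auto
    have px: "orth_proj (span (\<kappa> ` X)) (\<kappa> z) \<in> span (\<kappa> ` insert x X)" for z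
      using orth_proj_in_span[OF fin] sub by blast
    have "r x \<in> span (\<kappa> ` insert x X)"
      unfolding r_def by (intro span_diff px span_base) auto
    then have "g \<in> span (\<kappa> ` insert x X)"
      unfolding g_def by (intro span_add span_mul px)
    moreover have diff: "\<kappa> y - g = r y - c *\<^sub>R r x"
      by (simp add: g_def r_def)
    have "(\<kappa> y - g) \<bullet> b = 0" if b: "b \<in> \<kappa> ` insert x X" for b
    proof -
      consider "b = \<kappa> x" | "b \<in> \<kappa> ` X"
        using b by auto
      then show ?thesis
      proof cases
        case 1
        have "\<kappa> x = r x + orth_proj (span (\<kappa> ` X)) (\<kappa> x)"
          by (simp add: r_def)
        then have "r z \<bullet> b = r z \<bullet> r x" for z
          using 1 r_perp[OF orth_proj_in_span[OF fin]] by (metis add.right_neutral inner_add_right)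
        then show ?thesis
          using False by (simp add: diff inner_diff_left c_def inner_commute[of "r y" "r x"])
      next
        case 2
        then show ?thesis
          by (simp add: diff inner_diff_left r_perp span_base)
      qed
    qed
    ultimately have "orth_proj (span (\<kappa> ` insert x X)) (\<kappa> y) = g"
      by (intro orth_proj_eqI)
    then have "(power_function \<kappa> (insert x X) y)\<^sup>2 = (r y - c *\<^sub>R r x) \<bullet> (r y - c *\<^sub>R r x)"
      unfolding power_function_def by (simp only: diff power2_norm_eq_inner)
    also have "\<dots> = r y \<bullet> r y - (r x \<bullet> r y)\<^sup>2 / (r x \<bullet> r x)"
      using False
      by (simp add: inner_diff_left inner_diff_right c_def inner_commute power2_eq_square field_simps)
    finally have "(power_function \<kappa> (insert x X) y)\<^sup>2
      = r y \<bullet> r y - (r x \<bullet> r y)\<^sup>2 / (r x \<bullet> r x)" .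
    moreover have "(power_function \<kappa> X x)\<^sup>2 = r x \<bullet> r x"
      by (simp add: power_function_def r_def power2_norm_eq_inner)
    ultimately show ?thesis
      using False by (simp add: power_mult_distrib right_diff_distrib)
  qed
  show ?thesis
    by (rule power2_eq_imp_eq)
      (simp_all add: area power_function_nonneg inner_commute mult.commute)
qed

text \<open>Base times height: the volume of the parallelepiped spanned by the
  \<open>\<kappa> x\<close>, that is, the square root of the Gram determinant.\<close>

fun gram_vol :: "('x \<Rightarrow> 'h::real_inner) \<Rightarrow> 'x list \<Rightarrow> real" where
  "gram_vol \<kappa> [] = 1"
| "gram_vol \<kappa> (x # xs) = power_function \<kappa> (set xs) x * gram_vol \<kappa> xs"

text \<open>The exchange identity swaps neighbouring points, so any point can be moved to the front,
  where its height is the outermost factor.\<close>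

lemma gram_vol_move_front:
  "x \<in> set xs \<Longrightarrow> gram_vol \<kappa> (x # remove1 x xs) = gram_vol \<kappa> xs"
proof (induction xs)
  case (Cons y ys)
  show ?case
  proof (cases "x = y")
    case False
    define zs where "zs = remove1 x ys"
    have IH: "gram_vol \<kappa> (x # zs) = gram_vol \<kappa> ys" and x: "x \<in> set ys"
      using Cons False by (auto simp: zs_def)
    have ys: "set ys = insert x (set zs)"
      using x set_remove1_subset[of x ys] by (auto simp: zs_def) (metis in_set_remove1)
    have "gram_vol \<kappa> (x # y # zs) = gram_vol \<kappa> (y # x # zs)"
      using power_function_exchange[of "set zs" \<kappa> x y] by (simp add: mult_ac)
    also have "\<dots> = gram_vol \<kappa> (y # ys)"
      using IH ys by simp
    finally show ?thesis
      using False by (simp add: zs_def)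
  qed simp
qed simp

lemma gram_vol_nonneg: "0 \<le> gram_vol \<kappa> xs"
  by (induction xs) (auto simp: power_function_nonneg)

lemma gram_vol_le_1:
  assumes "\<And>x. x \<in> S \<Longrightarrow> norm (\<kappa> x) \<le> 1" and "set xs \<subseteq> S"
  shows "gram_vol \<kappa> xs \<le> 1"
  using assms(2)
proof (induction xs)
  case (Cons x xs)
  then have "power_function \<kappa> (set xs) x \<le> 1"
    using power_function_le_norm[of "set xs" \<kappa> x] assms(1)[of x] by simp
  then show ?case
    using Cons by (simp add: mult_le_one gram_vol_nonneg)
qed simp

text \<open>Take a list whose volume exceeds half the supremum; a maximum need not exist. Replacing
  \<open>x\<close> by \<open>z\<close> keeps the base and changes only the height, so the new height
  is at most twice the old one.\<close>

lemma almost_Fekete_points: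
  fixes \<kappa> :: "'x \<Rightarrow> 'h::real_inner"
  assumes bd: "\<And>x. x \<in> S \<Longrightarrow> norm (\<kappa> x) \<le> 1"
    and pos: "\<And>X. finite X \<Longrightarrow> X \<subseteq> S \<Longrightarrow> \<exists>x\<in>S. power_function \<kappa> X x > 0"
  obtains X where "finite X" "X \<subseteq> S" "card X = K"
    "\<And>x z. x \<in> X \<Longrightarrow> z \<in> S \<Longrightarrow> power_function \<kappa> (X - {x}) z \<le> 2 * power_function \<kappa> (X - {x}) x"
proof -
  define L where "L = {xs. length xs = K \<and> set xs \<subseteq> S}"
  define M where "M = (SUP xs\<in>L. gram_vol \<kappa> xs)"
  have bdd: "bdd_above (gram_vol \<kappa> ` L)"
    using gram_vol_le_1[OF bd] by (auto simp: L_def intro!: bdd_aboveI[where M = 1])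
  have "\<exists>xs. length xs = K \<and> set xs \<subseteq> S \<and> gram_vol \<kappa> xs > 0"
  proof (induction K)
    case (Suc K)
    then obtain xs where xs: "length xs = K" "set xs \<subseteq> S" "gram_vol \<kappa> xs > 0"
      by blast
    with pos[of "set xs"] obtain x where "x \<in> S" "power_function \<kappa> (set xs) x > 0"
      by auto
    with xs show ?case
      by (intro exI[of _ "x # xs"]) auto
  qed simp
  then obtain ys where ys: "ys \<in> L" "gram_vol \<kappa> ys > 0"
    by (auto simp: L_def)
  then have M: "M > 0"
    unfolding M_def using cSUP_upper[OF ys(1) bdd] by simp
  then obtain xs where xs: "xs \<in> L" "M / 2 < gram_vol \<kappa> xs"
    using less_cSUP_iff[OF _ bdd, of "M / 2"] ys(1) by (auto simp: M_def)
  have split: "set (remove1 x xs) = set xs - {x}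
      \<and> x \<notin> set (remove1 x xs)
      \<and> (\<forall>z\<in>S. power_function \<kappa> (set xs - {x}) z \<le> 2 * power_function \<kappa> (set xs - {x}) x)"
    if x: "x \<in> set xs" for x
  proof -
    define zs where "zs = remove1 x xs"
    have vol: "gram_vol \<kappa> xs = power_function \<kappa> (set zs) x * gram_vol \<kappa> zs"
      using gram_vol_move_front[OF x, of \<kappa>] by (simp add: zs_def)
    have "gram_vol \<kappa> xs > 0"
      using xs M by simp
    then have P: "power_function \<kappa> (set zs) x > 0" and v: "gram_vol \<kappa> zs > 0"
      using vol power_function_nonneg[of \<kappa> "set zs" x] gram_vol_nonneg[of \<kappa> zs]
      by (auto simp: zero_less_mult_iff)
    have nx: "x \<notin> set zs"
      using P power_function_eq_0[of "set zs" \<kappa> x] by (auto intro: span_base)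
    have set_zs: "set zs = set xs - {x}"
    proof (rule set_eqI)
      show "y \<in> set zs \<longleftrightarrow> y \<in> set xs - {x}" for y
        using nx by (cases "y = x") (auto simp: zs_def)
    qed
    have "power_function \<kappa> (set zs) z \<le> 2 * power_function \<kappa> (set zs) x" if "z \<in> S" for z
    proof -
      have "set zs \<subseteq> set xs"
        using set_zs by blast
      then have "z # zs \<in> L"
        using xs(1) x that by (auto simp: L_def zs_def length_remove1 dest: length_pos_if_in_set)
      then have "gram_vol \<kappa> (z # zs) \<le> 2 * gram_vol \<kappa> xs"
        using cSUP_upper[OF _ bdd, of "z # zs"] xs(2) by (simp add: M_def)
      then show ?thesis
        using v vol by simp
    qed
    then show ?thesis
      using nx set_zs by (simp add: zs_def)
  qed
  \<comment> \<open>A repeated point would survive in \<open>remove1 x xs\<close>, which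
    \<open>split\<close> excludes because its height would be 0.\<close>
  have "distinct xs"
  proof (rule ccontr)
    assume "\<not> distinct xs"
    then obtain as bs cs x where "xs = as @ [x] @ bs @ [x] @ cs"
      using not_distinct_decomp by blast
    then show False
      using split[of x] by (auto simp: remove1_append split: if_splits)
  qed
  then have "card (set xs) = K"
    using xs(1) by (simp add: distinct_card L_def)
  then show ?thesis
    using that[of "set xs"] split xs(1) by (auto simp: L_def)
qed

text \<open>
  Trace argument: for the basis \<open>b\<close> dual to \<open>\<kappa> ` X\<close>, the sum \<open>\<Sum>x\<in>X. \<Pi>\<^sub>V (\<kappa> x) \<bullet> b x\<close> is the trace of
  the composition of the projections onto \<open>V = span B\<close> and \<open>span (\<kappa> ` X)\<close>, hence at most \<open>dim V\<close>.
\<close>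

lemma width_ge_of_separated:
  fixes \<kappa> :: "'x \<Rightarrow> 'h::real_inner"
  assumes X: "finite X" and q: "q > 0" "\<And>x. x \<in> X \<Longrightarrow> q \<le> power_function \<kappa> (X - {x}) x"
    and B: "finite B" "card B \<le> m"
    and \<delta>: "\<And>x. x \<in> X \<Longrightarrow> infdist (\<kappa> x) (span B) \<le> \<delta>"
  shows "(real (card X) - real m) * q \<le> real (card X) * \<delta>"
proof -
  define l where "l x = \<kappa> x - orth_proj (span (\<kappa> ` (X - {x}))) (\<kappa> x)" for x
  \<comment> \<open>Dividing by the squared norm gives \<open>b x \<bullet> \<kappa> x = 1\<close>
    and makes \<open>norm (b x)\<close> the reciprocal of the height of
    \<open>\<kappa> x\<close>.\<close>
  define b where "b x = (1 / (l x \<bullet> l x)) *\<^sub>R l x" for x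
  have fin: "finite (\<kappa> ` (X - {x}))" for x
    using X by simp
  have nl: "q \<le> norm (l x)" if "x \<in> X" for x
    using q(2)[OF that] by (simp add: power_function_def l_def)
  have l0: "l x \<noteq> 0" if "x \<in> X" for x
    using nl[OF that] q(1) by auto
  have l_perp: "l x \<bullet> v = 0" if "v \<in> span (\<kappa> ` (X - {x}))" for x v
    using orth_proj_perp[OF fin that] by (simp add: l_def)
  have "l x \<bullet> \<kappa> x = l x \<bullet> l x" for x
    using l_perp[OF orth_proj_in_span[OF fin]]
    by (simp add: l_def inner_diff_right)
  then have dual1: "b x \<bullet> \<kappa> x = 1" if "x \<in> X" for x
    using l0[OF that] by (simp add: b_def)
  have dual0: "b x \<bullet> \<kappa> y = 0" if "y \<in> X" "x \<noteq> y" for x y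
    using l_perp[of "\<kappa> y" x] that by (auto simp: b_def intro: span_base)
  have inj: "inj_on \<kappa> X"
    using dual1 dual0 by (intro inj_onI) (metis zero_neq_one)
  have b_span: "b x \<in> span (\<kappa> ` X)" if "x \<in> X" for x
  proof -
    have "span (\<kappa> ` (X - {x})) \<subseteq> span (\<kappa> ` X)"
      by (intro span_mono) auto
    then have "orth_proj (span (\<kappa> ` (X - {x}))) (\<kappa> x) \<in> span (\<kappa> ` X)"
      using orth_proj_in_span[OF fin] by blast
    then show ?thesis
      unfolding b_def l_def using that by (simp add: span_mul span_diff span_base)
  qed
  have nb: "norm (b x) \<le> 1 / q" if "x \<in> X" for x
  proof -
    have "norm (b x) = 1 / norm (l x)"
      using l0[OF that] by (simp add: b_def dot_square_norm power2_eq_square)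
    also have "\<dots> \<le> 1 / q"
      using nl[OF that] q(1) by (intro divide_left_mono) (auto intro: mult_pos_pos less_le_trans)
    finally show ?thesis .
  qed
  have tr: "(\<Sum>x\<in>X. (v \<bullet> \<kappa> x) * (v \<bullet> b x)) \<le> v \<bullet> v" for v
  proof -
    define w where "w = orth_proj (span (\<kappa> ` X)) v"
    have finX: "finite (\<kappa> ` X)"
      using X by simp
    have w: "w \<in> span (\<kappa> ` X)"
      unfolding w_def by (rule orth_proj_in_span[OF finX])
    then obtain u where "w = (\<Sum>g\<in>\<kappa> ` X. u g *\<^sub>R g)"
      by (auto simp: span_finite[OF finX])
    then have w_eq: "w = (\<Sum>y\<in>X. u (\<kappa> y) *\<^sub>R \<kappa> y)"
      by (simp add: sum.reindex[OF inj])
    \<comment> \<open>By duality \<open>v \<bullet> b x\<close> is the coefficient of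
      \<open>\<kappa> x\<close> in \<open>w\<close>, so the sum collapses to
      \<open>v \<bullet> w\<close>, the squared norm of \<open>w\<close>.\<close>
    have "v \<bullet> b x = u (\<kappa> x)" if "x \<in> X" for x
    proof -
      have "(v - w) \<bullet> b x = 0"
        unfolding w_def by (rule orth_proj_perp[OF finX b_span[OF that]])
      then have "v \<bullet> b x = b x \<bullet> w"
        by (simp add: inner_diff_left) (simp add: inner_commute)
      also have "\<dots> = (\<Sum>y\<in>X. if y = x then u (\<kappa> y) else 0)"
        unfolding w_eq inner_sum_right using dual0 dual1 that by (intro sum.cong) auto
      finally show ?thesis
        using X that by simp
    qed
    then have "(\<Sum>x\<in>X. (v \<bullet> \<kappa> x) * (v \<bullet> b x)) = v \<bullet> w"
      unfolding w_eq by (simp add: inner_sum_right mult.commute)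
    also have "\<dots> \<le> v \<bullet> v"
    proof -
      have "(v - w) \<bullet> w = 0"
        unfolding w_def by (rule orth_proj_perp[OF finX orth_proj_in_span[OF finX]])
      then have "v \<bullet> v - v \<bullet> w = (v - w) \<bullet> (v - w)"
        by (simp add: inner_diff_left inner_diff_right inner_commute)
      then show ?thesis
        by (metis diff_ge_0_iff_ge inner_ge_zero)
    qed
    finally show ?thesis .
  qed
  obtain C where C: "finite C" "card C \<le> card B" "span C = span B" "pairwise orthogonal C"
    using basis_orthogonal[OF B(1)] by blast
  define p where "p x = orth_proj (span B) (\<kappa> x)" for x
  have p_eq: "p x = (\<Sum>v\<in>C. (v \<bullet> \<kappa> x / (v \<bullet> v)) *\<^sub>R v)" for x
    unfolding p_def using orth_proj_orthogonal_basis[OF C(1,4)] C(3) by simp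
  have "(\<Sum>x\<in>X. p x \<bullet> b x) = (\<Sum>x\<in>X. \<Sum>v\<in>C. (v \<bullet> \<kappa> x) * (v \<bullet> b x) / (v \<bullet> v))"
    by (simp add: p_eq inner_sum_left)
  also have "\<dots> = (\<Sum>v\<in>C. (\<Sum>x\<in>X. (v \<bullet> \<kappa> x) * (v \<bullet> b x)) / (v \<bullet> v))"
    by (subst sum.swap) (simp add: sum_divide_distrib)
  \<comment> \<open>Each vector of \<open>C\<close> contributes at most 1 by \<open>tr\<close>; a
    zero vector contributes 0, as division by zero gives 0.\<close>
  also have "\<dots> \<le> (\<Sum>v\<in>C. 1)"
    using tr by (intro sum_mono) (auto simp: divide_le_eq_1 inner_ge_zero less_le)
  also have "\<dots> \<le> real m"
    using C(2) B(2) by simp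
  finally have trace: "(\<Sum>x\<in>X. p x \<bullet> b x) \<le> real m" .
  \<comment> \<open>The first sum is \<open>card X\<close>, so the part missed by
    \<open>span B\<close> is at least \<open>card X - m\<close>; Cauchy-Schwarz bounds each of its
    summands by \<open>\<delta> / q\<close>.\<close>
  have "real (card X) - real m \<le> (\<Sum>x\<in>X. \<kappa> x \<bullet> b x) - (\<Sum>x\<in>X. p x \<bullet> b x)"
    using trace dual1 by (simp add: inner_commute)
  also have "\<dots> = (\<Sum>x\<in>X. (\<kappa> x - p x) \<bullet> b x)"
    by (simp add: inner_diff_left sum_subtractf)
  also have "\<dots> \<le> (\<Sum>x\<in>X. \<delta> * (1 / q))"
  proof (rule sum_mono)
    fix x assume x: "x \<in> X"
    have "norm (\<kappa> x - p x) \<le> \<delta>"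
      using \<delta>[OF x] by (simp add: p_def norm_diff_orth_proj[OF B(1)])
    then have "norm (\<kappa> x - p x) * norm (b x) \<le> \<delta> * (1 / q)"
      using nb[OF x] by (intro mult_mono) (auto intro: order_trans[OF norm_ge_zero])
    then show "(\<kappa> x - p x) \<bullet> b x \<le> \<delta> * (1 / q)"
      using norm_cauchy_schwarz[of "\<kappa> x - p x" "b x"] by linarith
  qed
  also have "\<dots> = real (card X) * \<delta> / q"
    by simp
  finally show ?thesis
    using q(1) by (simp add: field_simps)
qed

section \<open>The essential supremum of continuous functions\<close>

text \<open>The local defining function has nonzero gradient at a boundary point, hence turns
  negative along some direction, where the points are interior. This lets the essential supremum see
  values at boundary points.\<close>

lemma frontier_subset_closure_interior:
  fixes \<Omega> :: "(real^'d::finite) set"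
  assumes "smooth_boundary \<Omega>"
  shows "frontier \<Omega> \<subseteq> closure (interior \<Omega>)"
proof
  fix x assume x: "x \<in> frontier \<Omega>"
  then obtain U \<rho> D where U: "open U" "x \<in> U" and D: "smooth_partials U \<rho> D"
    and crit: "\<forall>y\<in>U. \<not> (\<rho> has_derivative (\<lambda>_. 0)) (at y)"
    and int: "U \<inter> interior \<Omega> = {y\<in>U. \<rho> y < 0}" and fr: "U \<inter> frontier \<Omega> = {y\<in>U. \<rho> y = 0}"
    using assms unfolding smooth_boundary_def by meson
  have "x \<in> U \<inter> frontier \<Omega>"
    using x U by simp
  then have \<rho>x: "\<rho> x = 0"
    unfolding fr by simp
  define L where "L h = (\<Sum>i\<in>UNIV. D ((\<lambda>_. 0)(i := Suc 0)) x * h $ i)" for h :: "real^'d"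
  have partials: "partials 1 U \<rho> D"
    using D unfolding smooth_partials_def by (rule spec)
  then have eq: "D (\<lambda>_. 0) y = \<rho> y" if "y \<in> U" for y
    using that unfolding partials_def by (elim conjE) (rule bspec)
  have "mi_order (\<lambda>_::'d. 0) < 1"
    by (simp add: mi_order_def)
  then have "(D (\<lambda>_. 0) has_derivative L) (at x within U)"
    using partials U(2) unfolding partials_def L_def[abs_def] by (elim conjE) (drule spec, drule mp, assumption, erule bspec)
  then have "(D (\<lambda>_. 0) has_derivative L) (at x)"
    unfolding at_within_open[OF U(2,1)] .
  then have L: "(\<rho> has_derivative L) (at x)"
    by (rule has_derivative_transform_within_open[OF _ U]) (rule eq)
  then interpret L: bounded_linear L
    by (rule has_derivative_bounded_linear)
  obtain h0 where "L h0 \<noteq> 0"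
  proof (rule ccontr)
    assume "\<not> thesis"
    then have "L = (\<lambda>_. 0)"
      using that by auto
    then show False
      using L crit U(2) by simp
  qed
  then have "L h0 < 0 \<or> L (- h0) < 0"
    by (auto simp: linear_neg[OF L.linear])
  then obtain h where h: "L h < 0"
    by blast
  define line where "line t = x + t *\<^sub>R h" for t
  have line: "(line has_derivative (\<lambda>t. t *\<^sub>R h)) (at 0)"
    unfolding line_def[abs_def] by (auto intro!: derivative_eq_intros)
  have "((\<lambda>t. \<rho> (line t)) has_derivative (\<lambda>t. L (t *\<^sub>R h))) (at 0)"
    by (rule has_derivative_compose[OF line]) (simp add: line_def L)
  then have "((\<lambda>t. \<rho> (line t)) has_field_derivative L h) (at 0)"
    unfolding has_field_derivative_def L.scaleR real_scaleR_def mult.commute[of _ "L h"] .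
  then obtain d where d: "d > 0" "\<And>t. 0 < t \<Longrightarrow> t < d \<Longrightarrow> \<rho> (line (0 + t)) < \<rho> (line 0)"
    using DERIV_neg_dec_right[OF _ h] by blast
  have neg: "\<rho> (line t) < 0" if "0 < t" "t < d" for t
    using d(2)[OF that] \<rho>x by (simp add: line_def)
  have "(line \<longlongrightarrow> x) (at_right 0)"
    unfolding line_def[abs_def] by (auto intro!: tendsto_eq_intros)
  show "x \<in> closure (interior \<Omega>)"
    unfolding closure_approachable
  proof (intro allI impI)
    fix e :: real assume "e > 0"
    then have "open (ball x e \<inter> U)" "x \<in> ball x e \<inter> U"
      using U by auto
    then have "\<forall>\<^sub>F t in at_right 0. line t \<in> ball x e \<inter> U"
      using \<open>(line \<longlongrightarrow> x) (at_right 0)\<close> by (rule topological_tendstoD[rotated])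
    moreover have "\<forall>\<^sub>F t in at_right (0::real). 0 < t \<and> t < d"
      using d(1) eventually_at_right by blast
    ultimately have "\<forall>\<^sub>F t in at_right 0. line t \<in> ball x e \<inter> U \<and> \<rho> (line t) < 0"
      by eventually_elim (simp add: neg)
    then obtain t where "line t \<in> ball x e \<inter> U" "\<rho> (line t) < 0"
      using eventually_happens'[OF trivial_limit_at_right_real] by blast
    then have "line t \<in> U \<inter> interior \<Omega>" "dist (line t) x < e"
      unfolding int by (simp_all add: dist_commute)
    then show "\<exists>y\<in>interior \<Omega>. dist y x < e"
      by blast
  qed
qed

lemma Linf_norm_le:
  fixes \<Omega> :: "(real^'d::finite) set"
  assumes "open \<Omega> \<or> closed \<Omega>" and "continuous_on \<Omega> g" and "\<And>y. y \<in> \<Omega> \<Longrightarrow> \<bar>g y\<bar> \<le> M"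
  shows "Linf_norm \<Omega> g \<le> ereal M"
proof -
  have "\<Omega> \<in> sets lebesgue"
    using assms(1) by auto
  then have [measurable]: "g \<in> borel_measurable (lebesgue_on \<Omega>)"
    using assms(2) by (rule continuous_imp_measurable_on_sets_lebesgue[rotated])
  show ?thesis
    unfolding Linf_norm_def
    by (rule esssup_I) (auto intro!: AE_I2 assms(3) simp: space_restrict_space)
qed

text \<open>By continuity \<open>|g|\<close> stays above any \<open>M < |g z|\<close> near
  \<open>z\<close>. By \<open>reg\<close> this neighbourhood contains a nonempty open subset of
  \<open>\<Omega>\<close>, which is not negligible.\<close>

lemma le_Linf_norm:
  fixes \<Omega> :: "(real^'d::finite) set"
  assumes meas: "open \<Omega> \<or> closed \<Omega>" and reg: "\<Omega> \<subseteq> closure (interior \<Omega>)"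
    and cont: "continuous_on \<Omega> g" and z: "z \<in> \<Omega>"
  shows "ereal \<bar>g z\<bar> \<le> Linf_norm \<Omega> g"
proof (rule ccontr)
  assume "\<not> ereal \<bar>g z\<bar> \<le> Linf_norm \<Omega> g"
  then obtain M where M: "Linf_norm \<Omega> g < ereal M" "M < \<bar>g z\<bar>"
    using ereal_dense2[of "Linf_norm \<Omega> g" "ereal \<bar>g z\<bar>"] by (auto simp: not_le)
  have sets: "\<Omega> \<in> sets lebesgue"
    using meas by auto
  obtain e where e: "e > 0" "\<And>y. y \<in> \<Omega> \<Longrightarrow> dist y z < e \<Longrightarrow> dist (g y) (g z) < \<bar>g z\<bar> - M"
    using cont z M(2) unfolding continuous_on_iff by (metis diff_gt_0_iff_gt)
  define W where "W = ball z e \<inter> interior \<Omega>"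
  have W: "open W" "W \<subseteq> \<Omega>"
    using interior_subset by (auto simp: W_def)
  obtain y where "y \<in> interior \<Omega>" "dist y z < e"
    using reg z e(1) by (meson closure_approachable subsetD)
  then have "y \<in> W"
    by (simp add: W_def dist_commute)
  then have "W \<noteq> {}"
    by blast
  have large: "M < \<bar>g y\<bar>" if "y \<in> W" for y
  proof -
    have "dist (g y) (g z) < \<bar>g z\<bar> - M"
      using that W(2) by (intro e(2)) (auto simp: W_def dist_commute)
    then show ?thesis
      by (auto simp: dist_real_def)
  qed
  have "AE y in lebesgue_on \<Omega>. ereal \<bar>g y\<bar> \<le> Linf_norm \<Omega> g"
    unfolding Linf_norm_def by (rule esssup_AE)
  then have "AE y in lebesgue_on \<Omega>. y \<notin> W"
  proof eventually_elim
    case (elim y)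
    then have "\<bar>g y\<bar> < M"
      using M(1) by (metis ereal_less_le less_ereal.simps(1) order_le_less_trans)
    then show ?case
      using large[of y] by auto
  qed
  then have "AE y in lebesgue. y \<notin> W"
    using sets W(2) by (auto simp: AE_restrict_space_iff elim: eventually_mono)
  then have "W \<in> null_sets lebesgue"
    using W(1) by (subst AE_iff_null_sets) auto
  then have "negligible W"
    by (simp add: negligible_iff_null_sets)
  then show False
    using W(1) \<open>W \<noteq> {}\<close> open_not_negligible by blast
qed

section \<open>Consequences of an error bound for the power function\<close>

lemma rkhs_eval: "is_rkhs ev \<kappa> S k \<Longrightarrow> x \<in> S \<Longrightarrow> ev f x = f \<bullet> \<kappa> x"
  by (simp add: is_rkhs_def)

lemma rkhs_inner: "is_rkhs ev \<kappa> S k \<Longrightarrow> x \<in> S \<Longrightarrow> y \<in> S \<Longrightarrow> \<kappa> x \<bullet> \<kappa> y = k y x"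
  by (simp add: is_rkhs_def)

text \<open>The squared distance of \<open>\<kappa> y\<close> and \<open>\<kappa> x\<close> is a
  combination of kernel values that is continuous in \<open>y\<close> and vanishes at
  \<open>y = x\<close>.\<close>

lemma continuous_on_feature_map:
  fixes \<kappa> :: "'x::topological_space \<Rightarrow> 'h::{real_inner,complete_space}"
  assumes rk: "is_rkhs ev \<kappa> S k" and cont: "continuous_on (S \<times> S) (\<lambda>(x, y). k x y)"
  shows "continuous_on S \<kappa>"
  unfolding continuous_on_def
proof
  fix x assume x: "x \<in> S"
  define h where "h y = k y y - 2 * k y x + k x x" for y
  have "continuous_on S (\<lambda>y. (\<lambda>(x, y). k x y) (y, y))"
    by (rule continuous_on_compose2[OF cont]) (auto intro!: continuous_intros)
  moreover have "continuous_on S (\<lambda>y. (\<lambda>(x, y). k x y) (y, x))"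
    by (rule continuous_on_compose2[OF cont]) (use x in \<open>auto intro!: continuous_intros\<close>)
  ultimately have "continuous_on S h"
    unfolding h_def[abs_def] by (auto intro!: continuous_intros)
  then have "continuous_on S (\<lambda>y. sqrt (h y))"
    by (intro continuous_intros)
  then have "((\<lambda>y. sqrt (h y)) \<longlongrightarrow> sqrt (h x)) (at x within S)"
    using x by (simp add: continuous_on_def)
  moreover have "norm (\<kappa> y - \<kappa> x) = sqrt (h y)" if "y \<in> S" for y
    using rkhs_inner[OF rk] x that
    by (simp add: norm_eq_sqrt_inner inner_diff_left inner_diff_right h_def)
      (metis inner_commute)
  ultimately have "((\<lambda>y. norm (\<kappa> y - \<kappa> x)) \<longlongrightarrow> 0) (at x within S)"
    by (subst tendsto_cong[where g = "\<lambda>y. sqrt (h y)"])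
      (auto simp: eventually_at_filter h_def)
  then show "(\<kappa> \<longlongrightarrow> \<kappa> x) (at x within S)"
    by (simp add: tendsto_norm_zero_iff LIM_zero_iff)
qed

text \<open>
  The residual of \<open>\<kappa> z\<close> at stage \<open>2 * n\<close> vanishes on \<open>X\<^sub>i\<close> for all \<open>i \<le> 2 * n\<close>, so that all the
  interpolants in the error bound are 0; its norm is \<open>P z\<close> and its value at \<open>z\<close> is \<open>(P z)\<^sup>2\<close>.
\<close>

lemma greedy_error_bound_imp_power_function_le:
  fixes \<Omega> :: "(real^'d::finite) set" and \<kappa> :: "real^'d \<Rightarrow> 'h::{real_inner,complete_space}"
  assumes \<Omega>: "open \<Omega> \<or> closed \<Omega>" "\<Omega> \<subseteq> closure (interior \<Omega>)"
    and rk: "is_rkhs ev \<kappa> \<Omega> k" and cont: "continuous_on \<Omega> \<kappa>"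
    and bound: "greedy_error_bound ev \<kappa> \<Omega> x \<rho>" and sel: "selected x (2 * n) \<subseteq> \<Omega>"
    and n: "n \<ge> 1" and z: "z \<in> \<Omega>" and P: "power_function \<kappa> (selected x (2 * n)) z > 0"
  shows "power_function \<kappa> (selected x (2 * n)) z \<le> \<rho> n"
proof -
  define X where "X = selected x (2 * n)"
  define f where "f = \<kappa> z - orth_proj (span (\<kappa> ` X)) (\<kappa> z)"
  have fin: "finite (\<kappa> ` X)"
    by (simp add: X_def selected_def)
  have perp: "f \<bullet> v = 0" if "v \<in> span (\<kappa> ` X)" for v
    using orth_proj_perp[OF fin that] by (simp add: f_def)
  have norm_f: "norm f = power_function \<kappa> X z"
    by (simp add: f_def power_function_def)
  have ev_f: "ev f z = (norm f)\<^sup>2"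
  proof -
    have "f \<bullet> \<kappa> z = f \<bullet> f"
      using perp[OF orth_proj_in_span[OF fin, of "\<kappa> z"]] by (simp add: f_def inner_diff_right)
    then show ?thesis
      by (simp add: rkhs_eval[OF rk z] power2_norm_eq_inner)
  qed
  have interp: "interpolant ev \<kappa> (selected x i) (ev f) = 0" if "i \<le> 2 * n" for i
    unfolding interpolant_def
  proof (rule the_equality)
    have sub: "selected x i \<subseteq> X"
      using that by (auto simp: selected_def X_def)
    then have in_\<Omega>: "y \<in> \<Omega>" if "y \<in> selected x i" for y
      using sel that by (auto simp: X_def)
    have ev_f0: "ev f y = 0" if "y \<in> selected x i" for y
      using perp[of "\<kappa> y"] that sub by (auto simp: rkhs_eval[OF rk in_\<Omega>] intro: span_base)
    then show "0 \<in> span (\<kappa> ` selected x i) \<and> (\<forall>y\<in>selected x i. ev 0 y = ev f y)"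
      by (simp add: span_zero rkhs_eval[OF rk in_\<Omega>])
    \<comment> \<open>Vanishing at the points means orthogonality to the generators, hence to the
      whole span and so to \<open>g\<close> itself.\<close>
    show "g = 0" if g: "g \<in> span (\<kappa> ` selected x i) \<and> (\<forall>y\<in>selected x i. ev g y = ev f y)" for g
    proof -
      have "orthogonal g b" if "b \<in> \<kappa> ` selected x i" for b
        using g ev_f0 that by (auto simp: orthogonal_def rkhs_eval[OF rk in_\<Omega>])
      then have "orthogonal g g"
        using g orthogonal_to_span by blast
      then show ?thesis
        by (simp add: orthogonal_self)
    qed
  qed
  define E where "E i = Linf_norm \<Omega> (\<lambda>y. ev f y - ev (interpolant ev \<kappa> (selected x i) (ev f)) y)" for i
  have "ereal ((norm f)\<^sup>2) \<le> E i" if "i \<in> {n + 1..2 * n}" for i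
  proof -
    define g where "g y = ev f y - ev 0 y" for y
    have g: "g y = f \<bullet> \<kappa> y" if "y \<in> \<Omega>" for y
      using that by (simp add: g_def rkhs_eval[OF rk])
    have "continuous_on \<Omega> (\<lambda>y. f \<bullet> \<kappa> y)"
      using cont by (intro continuous_intros)
    then have "continuous_on \<Omega> g"
      using g by (simp cong: continuous_on_cong)
    then have "ereal \<bar>g z\<bar> \<le> Linf_norm \<Omega> g"
      by (rule le_Linf_norm[OF \<Omega> _ z])
    moreover have "g z = (norm f)\<^sup>2"
      using g[OF z] ev_f by (simp add: rkhs_eval[OF rk z])
    ultimately show ?thesis
      using interp[of i] that by (simp add: E_def g_def[abs_def])
  qed
  then have "ereal ((norm f)\<^sup>2) \<le> Min (E ` {n + 1..2 * n})"
    using n by (subst Min_ge_iff) auto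
  also have "\<dots> \<le> ereal (\<rho> n * norm (f - interpolant ev \<kappa> (selected x (n + 1)) (ev f)))"
    using bound n unfolding greedy_error_bound_def E_def by blast
  also have "\<dots> = ereal (\<rho> n * norm f)"
    using interp[of "n + 1"] n by simp
  finally have "(norm f)\<^sup>2 \<le> \<rho> n * norm f"
    by simp
  \<comment> \<open>The assumption \<open>P\<close> enters here: one factor \<open>norm f\<close> is
    cancelled.\<close>
  moreover have "norm f > 0"
    using P by (simp add: norm_f X_def)
  ultimately have "norm f \<le> \<rho> n"
    by (simp add: power2_eq_square)
  then show ?thesis
    by (simp add: norm_f X_def)
qed

text \<open>For \<open>\<gamma> < 1\<close> a near-maximiser exists even if the supremum is not
  attained. This supplies a run to which (T) can be applied.\<close>

lemma weak_greedy_exists: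
  fixes \<kappa> :: "'x \<Rightarrow> 'h::real_inner"
  assumes ne: "\<Omega> \<noteq> {}" and bd: "\<And>z. z \<in> \<Omega> \<Longrightarrow> norm (\<kappa> z) \<le> 1" and \<gamma>: "\<gamma> < 1"
  obtains x where "weak_greedy \<kappa> \<Omega> \<gamma> x"
proof -
  define S where "S X = (SUP z\<in>\<Omega>. power_function \<kappa> X z)" for X
  have "\<exists>y\<in>\<Omega>. power_function \<kappa> X y \<ge> \<gamma> * S X" if "finite X" for X
  proof -
    have bdd: "bdd_above (power_function \<kappa> X ` \<Omega>)"
      using order_trans[OF power_function_le_norm[OF that] bd] by (auto intro!: bdd_aboveI[where M = 1])
    have upper: "power_function \<kappa> X y \<le> S X" if "y \<in> \<Omega>" for y
      unfolding S_def using that by (rule cSUP_upper[OF _ bdd])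
    obtain y0 where y0: "y0 \<in> \<Omega>"
      using ne by blast
    show ?thesis
    proof (cases "S X > 0")
      case True
      then have "\<gamma> * S X < S X"
        using \<gamma> by simp
      then show ?thesis
        using less_cSUP_iff[OF ne bdd] by (auto simp: S_def intro: less_imp_le)
    next
      case False
      then have "S X = 0"
        using upper[OF y0] power_function_nonneg[of \<kappa> X y0] by simp
      then show ?thesis
        using y0 by (auto simp: power_function_nonneg)
    qed
  qed
  then obtain c where c: "\<And>X. finite X \<Longrightarrow> c X \<in> \<Omega> \<and> power_function \<kappa> X (c X) \<ge> \<gamma> * S X"
    by metis
  \<comment> \<open>The choice depends only on the current set, so the sets are iterated first and
    the points read off. The index shift matches \<open>selected\<close>, which starts at 1.\<close>
  define Xs where "Xs n = ((\<lambda>X. insert (c X) X) ^^ n) {}" for n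
  define x where "x n = c (Xs (n - 1))" for n
  have Xs: "selected x n = Xs n" for n
  proof (induction n)
    case (Suc n)
    have "selected x (Suc n) = insert (x (Suc n)) (selected x n)"
      by (auto simp: selected_def atLeastAtMostSuc_conv)
    also have "x (Suc n) = c (Xs n)"
      by (simp add: x_def)
    finally show ?case
      using Suc by (simp add: Xs_def)
  qed (simp add: selected_def Xs_def)
  have "weak_greedy \<kappa> \<Omega> \<gamma> x"
    unfolding weak_greedy_def
  proof
    fix n
    have "finite (Xs n)"
      using Xs[of n] by (metis finite_atLeastAtMost finite_imageI selected_def)
    then show "x (Suc n) \<in> \<Omega> \<and> power_function \<kappa> (selected x n) (x (Suc n))
        \<ge> \<gamma> * (SUP z\<in>\<Omega>. power_function \<kappa> (selected x n) z)"
      using c[of "Xs n"] by (simp add: Xs S_def x_def)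
  qed
  then show ?thesis
    by (rule that)
qed

lemma selected_subset:
  assumes "weak_greedy \<kappa> \<Omega> \<gamma> x"
  shows "selected x n \<subseteq> \<Omega>"
proof -
  have "x i \<in> \<Omega>" if "i \<ge> 1" for i
    using assms that by (cases i) (simp_all add: weak_greedy_def)
  then show ?thesis
    by (auto simp: selected_def)
qed

section \<open>Absolutely convex hulls\<close>

lemma norm_co_le:
  assumes "\<And>g. g \<in> K \<Longrightarrow> norm g \<le> r" and "f \<in> co K" and "r \<ge> 0"
  shows "norm f \<le> r"
proof -
  have "norm (\<Sum>g\<in>S. c g *\<^sub>R g) \<le> r" if "finite S" "S \<subseteq> K" "(\<Sum>g\<in>S. \<bar>c g\<bar>) \<le> 1" for S c
  proof -
    have "norm (\<Sum>g\<in>S. c g *\<^sub>R g) \<le> (\<Sum>g\<in>S. \<bar>c g\<bar> * r)"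
      using assms(1) that(2) by (intro sum_norm_le) (auto intro!: mult_left_mono)
    also have "\<dots> \<le> 1 * r"
      unfolding sum_distrib_right[symmetric] using that(3) assms(3) by (rule mult_right_mono)
    finally show ?thesis
      by simp
  qed
  then have "co K \<subseteq> cball 0 r"
    unfolding co_def by (intro closure_minimal) auto
  then show ?thesis
    using assms(2) by auto
qed

lemma subset_co: "K \<subseteq> co K"
proof
  fix g assume "g \<in> K"
  then have "g \<in> {\<Sum>g\<in>S. c g *\<^sub>R g | S c. finite S \<and> S \<subseteq> K \<and> (\<Sum>g\<in>S. \<bar>c g\<bar>) \<le> 1}"
    by (intro CollectI exI[of _ "{g}"] exI[of _ "\<lambda>_. 1"]) simp
  then show "g \<in> co K"
    unfolding co_def by (rule subsetD[OF closure_subset])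
qed

text \<open>Boundedness provides an admissible radius through a single ball; \<open>Inf\<close> of
  the empty set would not be controlled.\<close>

lemma entropy_number_nonneg:
  fixes K :: "'h::real_normed_vector set"
  assumes "bounded K"
  shows "0 \<le> entropy_number n K"
  unfolding entropy_number_def
proof (rule cInf_greatest)
  obtain r where "r > 0" "K \<subseteq> cball 0 r"
    using assms bounded_pos by (metis mem_cball_0 subsetI)
  then have "r \<in> {\<epsilon>. \<epsilon> > 0 \<and> (\<exists>C. finite C \<and> card C \<le> 2 ^ n \<and> K \<subseteq> (\<Union>c\<in>C. cball c \<epsilon>))}"
    by (intro CollectI conjI exI[of _ "{0}"]) auto
  then show "{\<epsilon>. \<epsilon> > 0 \<and> (\<exists>C. finite C \<and> card C \<le> 2 ^ n \<and> K \<subseteq> (\<Union>c\<in>C. cball c \<epsilon>))} \<noteq> {}"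
    by blast
qed auto

text \<open>The assumption \<open>lower\<close> is (L) for pointwise bounds in place of the
  essential supremum. In the factor 1/4, one half comes from almost maximal volume, the other from
  the trace argument with \<open>2 * m\<close> points against dimension \<open>m\<close>.\<close>

lemma kolmogorov_width_co_ge:
  fixes \<kappa> :: "'x \<Rightarrow> 'h::real_inner"
  assumes ne: "\<Omega> \<noteq> {}" and bd: "\<And>z. z \<in> \<Omega> \<Longrightarrow> norm (\<kappa> z) \<le> 1"
    and c: "c > 0" and a: "a \<ge> 0"
    and lower: "\<And>X M. finite X \<Longrightarrow> X \<noteq> {} \<Longrightarrow> X \<subseteq> \<Omega> \<Longrightarrow> (\<And>z. z \<in> \<Omega> \<Longrightarrow> power_function \<kappa> X z \<le> M)
      \<Longrightarrow> c * real (card X) powr (- a) \<le> M"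
    and m: "m \<ge> 1"
  shows "c / 4 * real (2 * m) powr (- a) \<le> kolmogorov_width m (co (\<kappa> ` \<Omega>))"
proof -
  have pos: "\<exists>x\<in>\<Omega>. power_function \<kappa> X x > 0" if X: "finite X" "X \<subseteq> \<Omega>" for X
  proof (rule ccontr)
    assume "\<not> ?thesis"
    then have zero: "power_function \<kappa> X z \<le> 0" if "z \<in> \<Omega>" for z
      using that by (auto simp: not_less)
    obtain y where y: "y \<in> \<Omega>"
      using ne by blast
    \<comment> \<open>Adding \<open>y\<close> makes the set nonempty, as \<open>lower\<close>
      demands, and does not increase the power function.\<close>
    define Y where "Y = insert y X"
    have Y: "finite Y" "Y \<noteq> {}" "Y \<subseteq> \<Omega>"
      using X y by (auto simp: Y_def)
    have "power_function \<kappa> Y z \<le> power_function \<kappa> X z" for z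
      unfolding power_function_eq_infdist[OF Y(1)] power_function_eq_infdist[OF X(1)]
      by (intro infdist_mono span_mono) (auto simp: Y_def intro: span_zero)
    then have "c * real (card Y) powr (- a) \<le> 0"
      using zero by (intro lower[OF Y]) (blast intro: order_trans)
    moreover have "card Y > 0"
      using Y by (simp add: card_gt_0_iff)
    ultimately show False
      using c by (simp add: mult_le_0_iff)
  qed
  obtain X where X: "finite X" "X \<subseteq> \<Omega>" "card X = 2 * m"
    "\<And>x z. x \<in> X \<Longrightarrow> z \<in> \<Omega> \<Longrightarrow> power_function \<kappa> (X - {x}) z \<le> 2 * power_function \<kappa> (X - {x}) x"
    using almost_Fekete_points[of \<Omega> \<kappa> "2 * m", OF bd pos] by metis
  define q where "q = c / 2 * real (2 * m) powr (- a)"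
  have q0: "q > 0"
    using c m by (simp add: q_def)
  have q: "q \<le> power_function \<kappa> (X - {x}) x" if x: "x \<in> X" for x
  proof -
    have card: "card (X - {x}) = 2 * m - 1"
      using X x by simp
    have "card (X - {x}) \<noteq> 0"
      unfolding card using m by linarith
    then have "X - {x} \<noteq> {}"
      by (metis card.empty)
    then have "c * real (card (X - {x})) powr (- a) \<le> 2 * power_function \<kappa> (X - {x}) x"
      using X x by (intro lower) auto
    moreover have "real (2 * m) powr (- a) \<le> real (2 * m - 1) powr (- a)"
      using a m by (intro powr_mono2') auto
    then have "c * real (2 * m) powr (- a) \<le> c * real (2 * m - 1) powr (- a)"
      using c by (intro mult_left_mono) auto
    ultimately show ?thesis
      unfolding card q_def by linarith
  qed
  have "c / 4 * real (2 * m) powr (- a) \<le> (SUP f\<in>co (\<kappa> ` \<Omega>). infdist f (span B))"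
    if B: "finite B" "card B \<le> m" for B :: "'h set"
  proof -
    define \<delta> where "\<delta> = (SUP f\<in>co (\<kappa> ` \<Omega>). infdist f (span B))"
    have "infdist f (span B) \<le> 1" if "f \<in> co (\<kappa> ` \<Omega>)" for f
      using infdist_le[OF span_zero, of f B] norm_co_le[OF _ that, of 1] bd
      by (force simp: dist_norm)
    then have bdd: "bdd_above ((\<lambda>f. infdist f (span B)) ` co (\<kappa> ` \<Omega>))"
      by (auto intro!: bdd_aboveI[where M = 1])
    have "infdist (\<kappa> x) (span B) \<le> \<delta>" if "x \<in> X" for x
      unfolding \<delta>_def using that X(2) subset_co[of "\<kappa> ` \<Omega>"] by (intro cSUP_upper bdd) auto
    then have "(real (card X) - real m) * q \<le> real (card X) * \<delta>"
      by (intro width_ge_of_separated[OF X(1) q0 q B])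
    then have "real m * q \<le> real m * (2 * \<delta>)"
      by (simp add: X(3) algebra_simps)
    then have "q \<le> 2 * \<delta>"
      using m by simp
    then show ?thesis
      by (simp add: q_def \<delta>_def)
  qed
  moreover have "span {} \<in> {span B | B :: 'h set. finite B \<and> card B \<le> m}"
    by (intro CollectI exI[of _ "{}"]) simp
  ultimately show ?thesis
    unfolding kolmogorov_width_def by (intro cINF_greatest) blast+
qed

section \<open>Optimality of the rates\<close>

lemma bigo_of_le:
  fixes r \<rho> :: "nat \<Rightarrow> real"
  assumes "q > 0" and "\<And>n. n \<ge> 1 \<Longrightarrow> 0 \<le> r n" and "\<And>n. n \<ge> 1 \<Longrightarrow> q * r n \<le> \<rho> n"
  shows "r \<in> O(\<rho>)"
proof (rule bigoI[of _ "1 / q"])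
  have "norm (r n) \<le> 1 / q * norm (\<rho> n)" if "n \<ge> 1" for n
    using assms(1) assms(2,3)[OF that] by (simp add: field_simps)
  then show "\<forall>\<^sub>F n in at_top. norm (r n) \<le> 1 / q * norm (\<rho> n)"
    by (intro eventually_sequentiallyI[of 1])
qed

theorem proposition19:
  fixes \<Omega> :: "(real^'d::finite) set"
    and k :: "real^'d \<Rightarrow> real^'d \<Rightarrow> real"
    and ev :: "'h::{real_inner,complete_space} \<Rightarrow> real^'d \<Rightarrow> real"
    and \<kappa> :: "real^'d \<Rightarrow> 'h"
    and ev_bar :: "'g::{real_inner,complete_space} \<Rightarrow> real^'d \<Rightarrow> real"
    and \<kappa>_bar :: "real^'d \<Rightarrow> 'g"
    and ext :: "'h \<Rightarrow> 'g"
    and \<tau> s d :: real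
    and \<epsilon> :: "nat \<Rightarrow> real"
  assumes "\<Omega> \<noteq> {}" and "bounded \<Omega>" and "open \<Omega> \<or> closed \<Omega>" and "smooth_boundary \<Omega>"
    and "strictly_pos_def_kernel (closure \<Omega>) k"
    and "continuous_on (closure \<Omega> \<times> closure \<Omega>) (\<lambda>(x, y). k x y)"
    and "\<forall>x\<in>\<Omega>. k x x \<le> 1"
    and "is_rkhs ev \<kappa> \<Omega> k"
    and "is_rkhs ev_bar \<kappa>_bar (closure \<Omega>) k"
    and "\<forall>f. \<forall>x\<in>\<Omega>. ev_bar (ext f) x = ev f x"
    and "\<forall>f. norm (ext f) = norm f"
    and d_def: "d = real CARD('d)"
    and "\<tau> > d / 2"
    and s_def: "s = \<tau> - d / 2"
    and "embedded_in_sobolev ev \<tau> \<Omega>"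
    and "embedded_in_Lip ev s \<Omega>"
    and "norm_equivalent_sobolev ev \<tau> \<Omega>"
    and \<epsilon>_def: "\<epsilon> = (\<lambda>n. entropy_number n (co (\<kappa> ` \<Omega>)))"
  shows
    \<comment> \<open>(B) with \<open>\<gamma> = 1\<close> implies the decay of the power function; and given (L), (E) and (T),
        none of the rates of (E), (K), (B), (T) can be improved\<close>
    "(\<forall>c>0. \<exists>c'>0. \<forall>x.
        weak_greedy \<kappa> \<Omega> 1 x \<and>
        greedy_error_bound ev \<kappa> \<Omega> x (\<lambda>n. c * real n powr (- \<tau> / d + 1 / 2)) \<longrightarrow>
        (\<forall>n\<ge>1. Linf_norm \<Omega> (power_function \<kappa> (selected x (2 * n)))
                   \<le> ereal (c' * real (2 * n) powr (- \<tau> / d + 1 / 2))))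
     \<and>
     ((\<exists>c>0. \<forall>X. finite X \<and> X \<noteq> {} \<and> X \<subseteq> \<Omega> \<longrightarrow>
         ereal (c * real (card X) powr (- \<tau> / d + 1 / 2)) \<le> Linf_norm \<Omega> (power_function \<kappa> X)) \<and>
      (\<exists>C>0. \<forall>n\<ge>1. \<epsilon> n \<le> C * real n powr (- s / d - 1 / 2)) \<and>
      (\<forall>\<gamma> x. admissible \<Omega> \<gamma> \<and> weak_greedy \<kappa> \<Omega> \<gamma> x \<longrightarrow>
         greedy_error_bound ev \<kappa> \<Omega> x (\<lambda>n. sqrt 5 / \<gamma> * real n powr (1 / 2) * \<epsilon> n))
      \<longrightarrow>
      rate_not_improvable (\<lambda>n. real n powr (- s / d - 1 / 2))
        (\<lambda>\<rho>. \<forall>n\<ge>1. \<epsilon> n \<le> \<rho> n) \<and>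
      rate_not_improvable (\<lambda>n. real n powr (- s / d))
        (\<lambda>\<rho>. \<forall>n\<ge>1. kolmogorov_width n (co (\<kappa> ` \<Omega>)) \<le> \<rho> n) \<and>
      (\<forall>\<gamma> x. admissible \<Omega> \<gamma> \<and> weak_greedy \<kappa> \<Omega> \<gamma> x \<longrightarrow>
         rate_not_improvable (\<lambda>n. real n powr (- \<tau> / d + 1 / 2)) (greedy_error_bound ev \<kappa> \<Omega> x) \<and>
         rate_not_improvable (\<lambda>n. real n powr (1 / 2) * \<epsilon> n) (greedy_error_bound ev \<kappa> \<Omega> x)))"
proof -
  note ne = assms(1) and \<Omega> = assms(3) and smooth = assms(4) and cont_k = assms(6) and k_le = assms(7)
    and rk = assms(8)
  \<comment> \<open>The common exponent: \<open>a\<close> equals \<open>s / d\<close>, and all four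
    rates are expressed by it.\<close>
  define a where "a = \<tau> / d - 1 / 2"
  have "d > 0"
    by (simp add: d_def)
  then have a: "a > 0"
    using assms(13) by (simp add: a_def field_simps)
  have e1: "- \<tau> / d + 1 / 2 = - a" and e2: "- s / d = - a"
    using \<open>d > 0\<close> by (simp_all add: a_def s_def field_simps)
  have reg: "\<Omega> \<subseteq> closure (interior \<Omega>)"
  proof
    fix y assume "y \<in> \<Omega>"
    then have "y \<in> interior \<Omega> \<or> y \<in> frontier \<Omega>"
      using closure_subset by (auto simp: frontier_def)
    then show "y \<in> closure (interior \<Omega>)"
      using frontier_subset_closure_interior[OF smooth] closure_subset by blast
  qed
  have cont: "continuous_on \<Omega> \<kappa>"
    by (rule continuous_on_feature_map[OF rk continuous_on_subset[OF cont_k]])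
      (use closure_subset in auto)
  have bd: "norm (\<kappa> z) \<le> 1" if "z \<in> \<Omega>" for z
    using k_le that by (simp add: norm_eq_sqrt_inner rkhs_inner[OF rk])
  have cont_P: "continuous_on \<Omega> (power_function \<kappa> X)" if "finite X" for X
    using that cont by (rule continuous_on_power_function)
  have fin_sel: "finite (selected x n)" for x :: "nat \<Rightarrow> real^'d" and n
    by (simp add: selected_def)
  have Linf_P_le: "Linf_norm \<Omega> (power_function \<kappa> X) \<le> ereal M"
    if "finite X" "\<And>z. z \<in> \<Omega> \<Longrightarrow> power_function \<kappa> X z \<le> M" for X M
    using that by (intro Linf_norm_le[OF \<Omega> cont_P]) (simp_all add: power_function_nonneg)
  have powr_double: "real (2 * n) powr (- a) = 2 powr (- a) * real n powr (- a)" for n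
    by (simp add: powr_mult)

  \<comment> \<open>Decay of the power function along P-greedy runs\<close>
  have decay: "\<exists>c'>0. \<forall>x.
        weak_greedy \<kappa> \<Omega> 1 x \<and> greedy_error_bound ev \<kappa> \<Omega> x (\<lambda>n. c * real n powr (- a)) \<longrightarrow>
        (\<forall>n\<ge>1. Linf_norm \<Omega> (power_function \<kappa> (selected x (2 * n)))
                   \<le> ereal (c' * real (2 * n) powr (- a)))" if c: "c > 0" for c
  \<comment> \<open>The factor \<open>2 powr a\<close> pays for writing the rate in
    \<open>2 * n\<close> instead of \<open>n\<close>.\<close>
  proof (intro exI[of _ "c * 2 powr a"] conjI allI impI)
    fix x :: "nat \<Rightarrow> real^'d" and n :: nat
    assume run: "weak_greedy \<kappa> \<Omega> 1 x \<and> greedy_error_bound ev \<kappa> \<Omega> x (\<lambda>n. c * real n powr (- a))"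
      and n: "1 \<le> n"
    have "power_function \<kappa> (selected x (2 * n)) z \<le> c * real n powr (- a)" if z: "z \<in> \<Omega>" for z
    proof (cases "power_function \<kappa> (selected x (2 * n)) z > 0")
      case True
      show ?thesis
        using greedy_error_bound_imp_power_function_le[OF \<Omega> reg rk cont, OF _ _ n z True]
          run selected_subset[of \<kappa> \<Omega> 1 x "2 * n"] by blast
    next
      case False
      moreover have "0 \<le> c * real n powr (- a)"
        using c by simp
      ultimately show ?thesis
        by linarith
    qed
    moreover have "c * 2 powr a * real (2 * n) powr (- a) = c * real n powr (- a)"
      by (simp only: powr_double) (simp add: powr_minus)
    ultimately show "Linf_norm \<Omega> (power_function \<kappa> (selected x (2 * n)))
        \<le> ereal (c * 2 powr a * real (2 * n) powr (- a))"
      by (intro Linf_P_le fin_sel) (simp only:)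
  qed (use c in simp)

  \<comment> \<open>Lower bounds for all valid rates\<close>
  have optimal: "rate_not_improvable (\<lambda>n. real n powr (- a - 1 / 2)) (\<lambda>\<rho>. \<forall>n\<ge>1. \<epsilon> n \<le> \<rho> n) \<and>
      rate_not_improvable (\<lambda>n. real n powr (- a))
        (\<lambda>\<rho>. \<forall>n\<ge>1. kolmogorov_width n (co (\<kappa> ` \<Omega>)) \<le> \<rho> n) \<and>
      (\<forall>\<gamma> x. admissible \<Omega> \<gamma> \<and> weak_greedy \<kappa> \<Omega> \<gamma> x \<longrightarrow>
         rate_not_improvable (\<lambda>n. real n powr (- a)) (greedy_error_bound ev \<kappa> \<Omega> x) \<and>
         rate_not_improvable (\<lambda>n. real n powr (1 / 2) * \<epsilon> n) (greedy_error_bound ev \<kappa> \<Omega> x))"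
    if L: "\<exists>c>0. \<forall>X. finite X \<and> X \<noteq> {} \<and> X \<subseteq> \<Omega> \<longrightarrow>
         ereal (c * real (card X) powr (- a)) \<le> Linf_norm \<Omega> (power_function \<kappa> X)"
      and E: "\<exists>C>0. \<forall>n\<ge>1. \<epsilon> n \<le> C * real n powr (- a - 1 / 2)"
      and T: "\<forall>\<gamma> x. admissible \<Omega> \<gamma> \<and> weak_greedy \<kappa> \<Omega> \<gamma> x \<longrightarrow>
         greedy_error_bound ev \<kappa> \<Omega> x (\<lambda>n. sqrt 5 / \<gamma> * real n powr (1 / 2) * \<epsilon> n)"
  proof -
    obtain c where c: "c > 0" and c_le: "\<And>X. finite X \<Longrightarrow> X \<noteq> {} \<Longrightarrow> X \<subseteq> \<Omega> \<Longrightarrow>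
         ereal (c * real (card X) powr (- a)) \<le> Linf_norm \<Omega> (power_function \<kappa> X)"
      using L by blast
    \<comment> \<open>Pointwise bounds dominate the essential supremum, so (L) bounds them from
      below.\<close>
    have lower: "c * real (card X) powr (- a) \<le> M"
      if "finite X" "X \<noteq> {}" "X \<subseteq> \<Omega>" "\<And>z. z \<in> \<Omega> \<Longrightarrow> power_function \<kappa> X z \<le> M" for X M
      using order_trans[OF c_le[OF that(1-3)] Linf_P_le[OF that(1,4)]] by simp
    obtain C where C: "C > 0" and C_le: "\<And>n. n \<ge> 1 \<Longrightarrow> \<epsilon> n \<le> C * real n powr (- a - 1 / 2)"
      using E by blast
    have "bounded (co (\<kappa> ` \<Omega>))"
      using norm_co_le[of "\<kappa> ` \<Omega>" 1] bd by (auto simp: bounded_iff)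
    then have \<epsilon>_nonneg: "0 \<le> \<epsilon> n" for n
      by (simp add: \<epsilon>_def entropy_number_nonneg)
    \<comment> \<open>The factor \<open>2 powr (- a)\<close> stems from applying (L) to the
      selection at stage \<open>2 * n\<close>.\<close>
    define q where "q = c * 2 powr (- a)"
    have q: "q > 0"
      using c by (simp add: q_def)
    have rate: "q * real n powr (- a) \<le> \<rho> n"
      if run: "weak_greedy \<kappa> \<Omega> \<gamma> x" and bound: "greedy_error_bound ev \<kappa> \<Omega> x \<rho>" and n: "n \<ge> 1"
      for \<gamma> x \<rho> n
    proof -
      define X where "X = selected x (2 * n)"
      have X: "finite X" "X \<noteq> {}" "X \<subseteq> \<Omega>"
        using fin_sel n selected_subset[OF run] by (auto simp: X_def) (simp add: selected_def)
      have card: "0 < card X" "card X \<le> 2 * n"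
        using X card_image_le[of "{1..2 * n}" x] by (auto simp: card_gt_0_iff X_def selected_def)
      \<comment> \<open>Only \<open>card X \<le> 2 * n\<close> is known here; fewer points make the
        lower bound larger, as the exponent is negative.\<close>
      have "real (2 * n) powr (- a) \<le> real (card X) powr (- a)"
        using card a by (intro powr_mono2') auto
      then have "q * real n powr (- a) \<le> c * real (card X) powr (- a)"
        using c by (simp only: powr_double) (simp add: q_def mult.assoc)
      also have "\<dots> \<le> \<rho> n"
      proof (rule lower[OF X])
        have le: "power_function \<kappa> X z \<le> \<rho> n" if "z \<in> \<Omega>" "power_function \<kappa> X z > 0" for z
          using greedy_error_bound_imp_power_function_le[OF \<Omega> reg rk cont bound _ n that(1)]
            X(3) that(2) by (simp add: X_def)
        \<comment> \<open>As \<open>\<rho>\<close> is arbitrary, its positivity has to be derived: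
          by (L) some power function value is positive, and it lies below \<open>\<rho> n\<close>.
          This settles the points where the power function vanishes.\<close>
        have "\<exists>z\<in>\<Omega>. power_function \<kappa> X z > 0"
        proof (rule ccontr)
          assume "\<not> ?thesis"
          then have "c * real (card X) powr (- a) \<le> 0"
            by (intro lower[OF X]) (auto simp: not_less)
          then show False
            using c card by (simp add: mult_le_0_iff)
        qed
        then have "\<rho> n > 0"
          using le by fastforce
        then show "power_function \<kappa> X z \<le> \<rho> n" if "z \<in> \<Omega>" for z
          using le[OF that] by linarith
      qed
      finally show ?thesis .
    qed
    \<comment> \<open>The value 1/2 is admissible for open and closed sets alike; (T) for such a run
      turns \<open>rate\<close> into a lower bound for the entropy numbers.\<close>
    have "admissible \<Omega> (1 / 2)"
      using \<Omega> by (auto simp: admissible_def)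
    moreover obtain x where x: "weak_greedy \<kappa> \<Omega> (1 / 2) x"
      by (rule weak_greedy_exists[OF ne bd]) auto
    ultimately have bound: "greedy_error_bound ev \<kappa> \<Omega> x (\<lambda>n. sqrt 5 / (1 / 2) * real n powr (1 / 2) * \<epsilon> n)"
      using T by blast
    have \<epsilon>_ge: "q / (2 * sqrt 5) * real n powr (- a - 1 / 2) \<le> \<epsilon> n" if n: "n \<ge> 1" for n
    proof -
      have "q * real n powr (- a) \<le> sqrt 5 / (1 / 2) * real n powr (1 / 2) * \<epsilon> n"
        by (rule rate[OF x bound n])
      moreover have "real n powr (- a) = real n powr (1 / 2) * real n powr (- a - 1 / 2)"
        by (simp flip: powr_add)
      ultimately have "real n powr (1 / 2) * (q * real n powr (- a - 1 / 2))
          \<le> real n powr (1 / 2) * (2 * sqrt 5 * \<epsilon> n)"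
        by (simp add: mult_ac)
      then have "q * real n powr (- a - 1 / 2) \<le> 2 * sqrt 5 * \<epsilon> n"
        using n by simp
      then show ?thesis
        by (simp add: field_simps)
    qed
    have entropy: "(\<lambda>n. real n powr (- a - 1 / 2)) \<in> O(\<rho>)" if "\<forall>n\<ge>1. \<epsilon> n \<le> \<rho> n" for \<rho>
    proof (rule bigo_of_le[of "q / (2 * sqrt 5)"])
      show "q / (2 * sqrt 5) * real n powr (- a - 1 / 2) \<le> \<rho> n" if "n \<ge> 1" for n
        using order_trans[OF \<epsilon>_ge[OF that]] \<open>\<forall>n\<ge>1. \<epsilon> n \<le> \<rho> n\<close> that by simp
    qed (use q in auto)
    have width: "(\<lambda>n. real n powr (- a)) \<in> O(\<rho>)"
      if \<rho>: "\<forall>n\<ge>1. kolmogorov_width n (co (\<kappa> ` \<Omega>)) \<le> \<rho> n" for \<rho>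
    proof (rule bigo_of_le[of "q / 4"])
      fix n :: nat assume n: "n \<ge> 1"
      have "q / 4 * real n powr (- a) = c / 4 * real (2 * n) powr (- a)"
        by (simp only: powr_double) (simp add: q_def)
      also have "\<dots> \<le> kolmogorov_width n (co (\<kappa> ` \<Omega>))"
        using a by (intro kolmogorov_width_co_ge[OF ne bd c _ lower n]) auto
      finally show "q / 4 * real n powr (- a) \<le> \<rho> n"
        using \<rho> n by fastforce
    qed (use q in auto)
    have greedy: "(\<lambda>n. real n powr (- a)) \<in> O(\<rho>)"
      "(\<lambda>n. real n powr (1 / 2) * \<epsilon> n) \<in> O(\<rho>)"
      if "weak_greedy \<kappa> \<Omega> \<gamma> x" and "greedy_error_bound ev \<kappa> \<Omega> x \<rho>" for \<gamma> x \<rho>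
    proof -
      show "(\<lambda>n. real n powr (- a)) \<in> O(\<rho>)"
        by (rule bigo_of_le[OF q]) (use rate[OF that] in auto)
      \<comment> \<open>Here (E) enters: it bounds the rate of (T) by a multiple of
        \<open>n powr (- a)\<close>, which \<open>rate\<close> bounds in terms of
        \<open>\<rho>\<close>.\<close>
      show "(\<lambda>n. real n powr (1 / 2) * \<epsilon> n) \<in> O(\<rho>)"
      proof (rule bigo_of_le[of "q / C"])
        fix n :: nat assume n: "n \<ge> 1"
        have "real n powr (1 / 2) * \<epsilon> n \<le> real n powr (1 / 2) * (C * real n powr (- a - 1 / 2))"
          using C_le[OF n] by (rule mult_left_mono) simp
        also have "\<dots> = C * real n powr (- a)"
          by (simp add: mult.left_commute[of _ C] flip: powr_add)
        finally have "q / C * (real n powr (1 / 2) * \<epsilon> n) \<le> q / C * (C * real n powr (- a))"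
          using q C by (intro mult_left_mono) auto
        also have "\<dots> = q * real n powr (- a)"
          using C by simp
        also have "\<dots> \<le> \<rho> n"
          by (rule rate[OF that n])
        finally show "q / C * (real n powr (1 / 2) * \<epsilon> n) \<le> \<rho> n" .
      qed (use q C \<epsilon>_nonneg in auto)
    qed
    show ?thesis
      unfolding rate_not_improvable_def
    proof (intro conjI allI impI)
      show "(\<lambda>n. real n powr (- a - 1 / 2)) \<in> O(\<rho>)" if "\<forall>n\<ge>1. \<epsilon> n \<le> \<rho> n" for \<rho>
        using that by (rule entropy)
      show "(\<lambda>n. real n powr (- a)) \<in> O(\<rho>)"
        if "\<forall>n\<ge>1. kolmogorov_width n (co (\<kappa> ` \<Omega>)) \<le> \<rho> n" for \<rho>
        using that by (rule width)
    qed (elim conjE, rule greedy, assumption+)+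
  qed

  show ?thesis
    unfolding e1 e2
    by (rule conjI[OF allI[OF impI] impI], erule decay, elim conjE, rule optimal)
qed

end
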